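(* Let $V$ be a finite-dimensional Euclidean space with Gaussian measure $d\mu$, and let $S_k:V_{\mathbb C}^{\otimes k}\to\mathbb{C}$, $k\ge 1$, be linear maps invariant under the symmetric groups. Let $x_1,x_2,\dots$ be variables and let $Z_{x_*}$ be the graphical calculus for the symmetric algebra $(V_{\mathbb C},(-,-),x_1S_1,x_2S_2,\dots)$. Then the following asymptotic expansion holds: $$\int_V\exp\Bigl\{\sum_{k=1}^\infty x_k\frac{S_k(v^{\otimes k})}{k!}\Bigr\}\,d\mu(v)=\sum_{\Gamma\in G(0,0)}\frac{Z_{x_*}(\Gamma)}{|\mathrm{Aut}\,\Gamma|},$$ where the sum on the right ranges over the set $G(0,0)$ of all isomorphism classes of (possibly disconnected) ordinary graphs of type $(0,0)$. The equality is to be read as an identity of formal power series in $x_1,x_2,\dots$, the left-hand side being expanded in Taylor series in the $x_k$ and integrated term by term.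
   Context: $V_{\mathbb C}=V\otimes_{\mathbb R}\mathbb C$. The Gaussian measure on $V$ is the probability measure $d\mu(v)=\frac1A e^{-\frac12(v,v)}dv$, $A=\int_V e^{-\frac12(v,v)}dv$, with $dv$ a non-trivial translation invariant measure. Invariance under the symmetric group means $S_k(X_1\otimes\cdots\otimes X_k)=S_k(X_{\sigma(1)}\otimes\cdots\otimes X_{\sigma(k)})$ for all permutations $\sigma$ of $\{1,\dots,k\}$. An ordinary graph of type $(0,0)$ (no endpoints) is a finite graph, possibly disconnected or empty, with loops and multiple edges allowed; vertices have any valence $\ge1$ and there are no vertexless circle components. Equivalently: a finite set $H$ of half-edges with a partition of $H$ into nonempty blocks (the vertices) and a fixed-point-free involution $\sigma_1$ of $H$ (whose orbits are the edges). Isomorphisms are bijections of half-edges preserving the vertex partition and commuting with $\sigma_1$; $\mathrm{Aut}\,\Gamma$ is the group of automorphisms (so it acts faithfully on half-edges). Graphical calculus: for a symmetric algebra $(V_{\mathbb C},(-,-),A_1,A_2,\dots)$ and a graph $\Gamma$ of type $(0,0)$, the number $Z(\Gamma)$ is obtained by placing $A_k$ on each $k$-valent vertex and contracting along each edge with the Casimir element $\sum_i e_i\otimes e_i$, $\{e_i\}_{i=1}^d$ an orthonormal basis of $V$; i.e. $Z(\Gamma)=\sum_c\prod_v A_{k_v}(e_{c(h_1)}\otimes\cdots\otimes e_{c(h_{k_v})})$, where $c$ runs over maps from the set of edges to $\{1,\dots,d\}$, $h_1,\dots,h_{k_v}$ are the half-edges at the vertex $v$, and $c(h)$ is the value of $c$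 on the edge containing $h$. The empty graph has value $1$. For $Z_{x_*}$ one takes $A_k=x_kS_k$. *)

theory Defs
  imports
    "HOL-Analysis.Analysis"
    "HOL-Library.Poly_Mapping"
    "HOL-Library.Disjoint_Sets"
    "HOL-Combinatorics.List_Permutation"
begin

section \<open>Formal power series in arbitrarily many variables\<close>

text \<open>
  Variables are indexed by \<open>'x\<close>; a monomial is a finitely supported exponent function
  \<open>'x \<Rightarrow>\<^sub>0 nat\<close>, and a series is an arbitrary coefficient function on monomials.
\<close>

typedef ('x, 'c) mps = "UNIV :: (('x \<Rightarrow>\<^sub>0 nat) \<Rightarrow> 'c) set"
  morphisms mps_coeff Abs_mps
  by simp

lemma mps_coeff_Abs [simp]: "mps_coeff (Abs_mps f) = f"
  by (simp add: Abs_mps_inverse)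

lemma mps_eqI: "(\<And>n. mps_coeff f n = mps_coeff g n) \<Longrightarrow> f = g"
  by (metis ext mps_coeff_inject)

lemma finite_le_poly_mapping: "finite {a :: 'x \<Rightarrow>\<^sub>0 nat. \<exists>b. a + b = n}" (is "finite ?A")
proof (rule finite_imageD)
  let ?F = "{f. \<forall>x. (x \<in> Poly_Mapping.keys n \<longrightarrow> f x \<in> {..Max (Poly_Mapping.lookup n ` Poly_Mapping.keys n)}) \<and> (x \<notin> Poly_Mapping.keys n \<longrightarrow> f x = 0)}"
  have "Poly_Mapping.lookup a \<in> ?F" if "a + b = n" for a b :: "'x \<Rightarrow>\<^sub>0 nat"
  proof -
    have le: "Poly_Mapping.lookup a x \<le> Poly_Mapping.lookup n x" for x
      unfolding that[symmetric] by (subst lookup_add) (rule le_add1)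
    have "Poly_Mapping.lookup a x \<le> Max (Poly_Mapping.lookup n ` Poly_Mapping.keys n)" if "x \<in> Poly_Mapping.keys n" for x
      by (rule order_trans[OF le Max_ge]) (simp_all add: that)
    moreover have "Poly_Mapping.lookup a x = 0" if "x \<notin> Poly_Mapping.keys n" for x
      using le[of x] that by (simp add: in_keys_iff)
    ultimately show ?thesis
      by simp
  qed
  then have "Poly_Mapping.lookup ` ?A \<subseteq> ?F"
    by (intro image_subsetI) (elim CollectE exE)
  then show "finite (Poly_Mapping.lookup ` ?A)"
    by (rule finite_subset) (intro finite_set_of_finite_funs; simp)
  show "inj_on Poly_Mapping.lookup ?A"
    by (auto simp: inj_on_def intro: poly_mapping_eqI)
qed

lemma finite_sum_eq_poly_mapping: "finite {(a, b). a + b = (n :: 'x \<Rightarrow>\<^sub>0 nat)}"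
proof (rule finite_subset)
  show "{(a, b). a + b = n} \<subseteq> {a. \<exists>b. a + b = n} \<times> {a. \<exists>b. a + b = n}"
  proof (rule subsetI)
    fix p assume "p \<in> {(a, b). a + b = n}"
    then have p: "fst p + snd p = n"
      by (simp add: case_prod_unfold)
    then have "snd p + fst p = n"
      by (simp only: add.commute)
    with p have "(fst p, snd p) \<in> {a. \<exists>b. a + b = n} \<times> {a. \<exists>b. a + b = n}"
      by blast
    then show "p \<in> {a. \<exists>b. a + b = n} \<times> {a. \<exists>b. a + b = n}"
      by simp
  qed
  show "finite ({a. \<exists>b. a + b = n} \<times> {a. \<exists>b. a + b = n})"
    by (intro finite_cartesian_product finite_le_poly_mapping)
qed

instantiation mps :: (type, comm_ring_1) comm_ring_1
begin

definition zero_mps :: "('a, 'b) mps" where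
  "0 = Abs_mps (\<lambda>n. 0)"

definition one_mps :: "('a, 'b) mps" where
  "1 = Abs_mps (\<lambda>n. if n = 0 then 1 else 0)"

definition plus_mps :: "('a, 'b) mps \<Rightarrow> ('a, 'b) mps \<Rightarrow> ('a, 'b) mps" where
  "f + g = Abs_mps (\<lambda>n. mps_coeff f n + mps_coeff g n)"

definition minus_mps :: "('a, 'b) mps \<Rightarrow> ('a, 'b) mps \<Rightarrow> ('a, 'b) mps" where
  "f - g = Abs_mps (\<lambda>n. mps_coeff f n - mps_coeff g n)"

definition uminus_mps :: "('a, 'b) mps \<Rightarrow> ('a, 'b) mps" where
  "- f = Abs_mps (\<lambda>n. - mps_coeff f n)"

definition times_mps :: "('a, 'b) mps \<Rightarrow> ('a, 'b) mps \<Rightarrow> ('a, 'b) mps" where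
  "f * g = Abs_mps (\<lambda>n. \<Sum>(a, b)\<in>{(a, b). a + b = n}. mps_coeff f a * mps_coeff g b)"

instance
proof
  fix f g h :: "('a, 'b) mps"
  let ?S = "\<lambda>n :: 'a \<Rightarrow>\<^sub>0 nat. {(a, b). a + b = n}"
  have fin: "finite {p. fst p + snd p = n}" for n :: "'a \<Rightarrow>\<^sub>0 nat"
    using finite_sum_eq_poly_mapping[of n] by (simp add: case_prod_unfold)
  show comm: "f * g = g * f" for f g :: "('a, 'b) mps"
  proof (rule mps_eqI)
    fix n
    have "(\<Sum>(a, b)\<in>?S n. mps_coeff f a * mps_coeff g b)
        = (\<Sum>(a, b)\<in>?S n. mps_coeff g a * mps_coeff f b)"
      by (rule sum.reindex_bij_witness[where i = prod.swap and j = prod.swap])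
        (auto simp: add.commute mult.commute)
    then show "mps_coeff (f * g) n = mps_coeff (g * f) n"
      by (simp add: times_mps_def)
  qed
  show "f * g * h = f * (g * h)"
  proof (rule mps_eqI)
    fix n
    have "(\<Sum>(p, c)\<in>?S n. (\<Sum>(a, b)\<in>?S p. mps_coeff f a * mps_coeff g b) * mps_coeff h c)
        = (\<Sum>((p, c), (a, b))\<in>(SIGMA z:?S n. ?S (fst z)).
             mps_coeff f a * mps_coeff g b * mps_coeff h c)"
      by (subst sum.Sigma[symmetric]) (auto simp: sum_distrib_right case_prod_unfold fin)
    also have "\<dots> = (\<Sum>((a, p), (b, c))\<in>(SIGMA z:?S n. ?S (snd z)).
             mps_coeff f a * (mps_coeff g b * mps_coeff h c))"
      by (rule sum.reindex_bij_witness
          [where i = "\<lambda>((a, p), (b, c)). ((a + b, c), (a, b))"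
             and j = "\<lambda>((p, c), (a, b)). ((a, b + c), (b, c))"])
        (auto simp: add.assoc mult.assoc)
    also have "\<dots> = (\<Sum>(a, p)\<in>?S n. mps_coeff f a * (\<Sum>(b, c)\<in>?S p. mps_coeff g b * mps_coeff h c))"
      by (subst sum.Sigma[symmetric]) (auto simp: sum_distrib_left case_prod_unfold fin)
    finally show "mps_coeff (f * g * h) n = mps_coeff (f * (g * h)) n"
      by (simp add: times_mps_def)
  qed
  show "1 * f = f"
  proof (rule mps_eqI)
    fix n
    have "(\<Sum>(a, b)\<in>?S n. (if a = 0 then 1 else 0) * mps_coeff f b)
        = (\<Sum>(a, b)\<in>{(0 :: 'a \<Rightarrow>\<^sub>0 nat, n)}. (if a = 0 then 1 else 0) * mps_coeff f b)"
      by (rule sum.mono_neutral_right) (auto simp: case_prod_unfold fin)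
    then show "mps_coeff (1 * f) n = mps_coeff f n"
      by (simp add: times_mps_def one_mps_def)
  qed
  show "(f + g) * h = f * h + g * h"
    by (rule mps_eqI)
      (simp add: times_mps_def plus_mps_def case_prod_unfold distrib_right sum.distrib)
  show "(0 :: ('a, 'b) mps) \<noteq> 1"
  proof
    assume "(0 :: ('a, 'b) mps) = 1"
    then have "mps_coeff (0 :: ('a, 'b) mps) 0 = mps_coeff 1 0"
      by simp
    then show False
      by (simp add: zero_mps_def one_mps_def)
  qed
  show "f + g + h = f + (g + h)"
    by (rule mps_eqI) (simp add: plus_mps_def add.assoc)
  show "f + g = g + f"
    by (rule mps_eqI) (simp add: plus_mps_def add.commute)
  show "0 + f = f"
    by (rule mps_eqI) (simp add: plus_mps_def zero_mps_def)
  show "- f + f = 0"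
    by (rule mps_eqI) (simp add: plus_mps_def zero_mps_def uminus_mps_def)
  show "f - g = f + - g"
    by (rule mps_eqI) (simp add: plus_mps_def minus_mps_def uminus_mps_def)
qed

end

definition mps_const :: "'c \<Rightarrow> ('x, 'c :: zero) mps" where
  "mps_const c = Abs_mps (\<lambda>n. if n = 0 then c else 0)"

definition mps_var :: "'x \<Rightarrow> ('x, 'c :: zero_neq_one) mps" where
  "mps_var k = Abs_mps (\<lambda>n. if n = Poly_Mapping.single k 1 then 1 else 0)"

text \<open>
  An infinite family can be summed formally if each monomial occurs in only finitely many members.
\<close>

definition formally_summable :: "('i \<Rightarrow> ('x, 'c :: comm_monoid_add) mps) \<Rightarrow> 'i set \<Rightarrow> bool" where
  "formally_summable f I \<longleftrightarrow> (\<forall>n. finite {i \<in> I. mps_coeff (f i) n \<noteq> 0})"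

definition formal_sum :: "('i \<Rightarrow> ('x, 'c :: comm_monoid_add) mps) \<Rightarrow> 'i set \<Rightarrow> ('x, 'c) mps" where
  "formal_sum f I = Abs_mps (\<lambda>n. \<Sum>i\<in>{i \<in> I. mps_coeff (f i) n \<noteq> 0}. mps_coeff (f i) n)"

text \<open>
  The exponential is meaningful for series with zero constant term, where the family
  of \<open>f ^ j / j!\<close> is formally summable.
\<close>

definition mps_exp :: "('x, 'c :: field_char_0) mps \<Rightarrow> ('x, 'c) mps" where
  "mps_exp f = formal_sum (\<lambda>j. mps_const (1 / fact j) * f ^ j) UNIV"

definition mps_integrable :: "'a measure \<Rightarrow> ('a \<Rightarrow> ('x, complex) mps) \<Rightarrow> bool" where
  "mps_integrable M F \<longleftrightarrow> (\<forall>n. integrable M (\<lambda>v. mps_coeff (F v) n))"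

definition mps_integral :: "'a measure \<Rightarrow> ('a \<Rightarrow> ('x, complex) mps) \<Rightarrow> ('x, complex) mps" where
  "mps_integral M F = Abs_mps (\<lambda>n. LINT v|M. mps_coeff (F v) n)"


section \<open>Euclidean spaces and Gaussian measures\<close>

text \<open>
  A finite-dimensional Euclidean space is a type of class \<^class>\<open>real_inner\<close> with a finite
  orthonormal basis. The class \<^class>\<open>euclidean_space\<close> is not used because
  it excludes the zero space.
\<close>

definition orthonormal_basis :: "nat \<Rightarrow> (nat \<Rightarrow> 'a :: real_inner) \<Rightarrow> bool" where
  "orthonormal_basis d e \<longleftrightarrow>
     (\<forall>i<d. \<forall>j<d. e i \<bullet> e j = (if i = j then 1 else 0)) \<and> span (e ` {..<d}) = UNIV"

text \<open>
  Local finiteness is part of the usual meaning of an invariant measure on a vector space; it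
  excludes, for example, the counting measure.
\<close>

definition translation_invariant_measure :: "'a :: real_normed_vector measure \<Rightarrow> bool" where
  "translation_invariant_measure dv \<longleftrightarrow>
     sets dv = sets borel \<and>
     (\<forall>a. distr dv borel (\<lambda>v. a + v) = dv) \<and>
     (\<forall>K. compact K \<longrightarrow> emeasure dv K < \<infinity>) \<and>
     emeasure dv UNIV \<noteq> 0"

definition gaussian :: "'a :: real_inner measure \<Rightarrow> 'a measure" where
  "gaussian dv =
     density dv (\<lambda>v. ennreal (1 / (LINT w|dv. exp (- (1/2) * (w \<bullet> w))) * exp (- (1/2) * (v \<bullet> v))))"


section \<open>Complexification and symmetric multilinear forms\<close>

text \<open>The pair \<open>(u, v)\<close> stands for \<open>u + \<i> v\<close>.\<close>

type_synonym 'a complexification = "'a \<times> 'a"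

definition cscale :: "complex \<Rightarrow> 'a :: real_vector complexification \<Rightarrow> 'a complexification" where
  "cscale z p = (Re z *\<^sub>R fst p - Im z *\<^sub>R snd p, Re z *\<^sub>R snd p + Im z *\<^sub>R fst p)"

definition of_V :: "'a :: real_vector \<Rightarrow> 'a complexification" where
  "of_V v = (v, 0)"

lemma vector_space_cscale: "vector_space (cscale :: complex \<Rightarrow> 'a :: real_vector complexification \<Rightarrow> _)"
  by unfold_locales (auto simp: cscale_def algebra_simps)

text \<open>
  A linear map \<open>V\<^sub>\<complex>\<^sup>\<otimes>\<^sup>k \<rightarrow> \<complex>\<close> is given by its values
  \<open>S [X\<^sub>1, \<dots>, X\<^sub>k]\<close> on pure tensors, i.e. by a complex multilinear function of
  lists of length \<open>k\<close>. Values on lists of other lengths are irrelevant.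
\<close>

definition tensor_linear :: "nat \<Rightarrow> ('a :: real_vector complexification list \<Rightarrow> complex) \<Rightarrow> bool" where
  "tensor_linear k S \<longleftrightarrow>
     (\<forall>Xs Ys. length Xs + 1 + length Ys = k \<longrightarrow>
        Vector_Spaces.linear cscale (*) (\<lambda>X. S (Xs @ X # Ys)))"

definition tensor_symmetric :: "nat \<Rightarrow> ('v list \<Rightarrow> complex) \<Rightarrow> bool" where
  "tensor_symmetric k S \<longleftrightarrow>
     (\<forall>Xs \<sigma>. length Xs = k \<longrightarrow> \<sigma> permutes {..<k} \<longrightarrow> S (permute_list \<sigma> Xs) = S Xs)"


section \<open>Graphs without endpoints\<close>

text \<open>
  A vertex is the set of half-edges incident to it. The involution only matters on
  \<open>half_edges\<close>; its values elsewhere are identified by the isomorphism relation below.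
\<close>

record 'h graph =
  half_edges :: "'h set"
  vertices :: "'h set set"
  flip :: "'h \<Rightarrow> 'h"

definition is_graph :: "'h graph \<Rightarrow> bool" where
  "is_graph \<Gamma> \<longleftrightarrow>
     finite (half_edges \<Gamma>) \<and>
     partition_on (half_edges \<Gamma>) (vertices \<Gamma>) \<and>
     (\<forall>h\<in>half_edges \<Gamma>. flip \<Gamma> h \<in> half_edges \<Gamma> \<and> flip \<Gamma> (flip \<Gamma> h) = h \<and> flip \<Gamma> h \<noteq> h)"

definition graph_iso :: "('h \<Rightarrow> 'k) \<Rightarrow> 'h graph \<Rightarrow> 'k graph \<Rightarrow> bool" where
  "graph_iso \<phi> \<Gamma> \<Gamma>' \<longleftrightarrow>
     bij_betw \<phi> (half_edges \<Gamma>) (half_edges \<Gamma>') \<and>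
     (\<lambda>v. \<phi> ` v) ` vertices \<Gamma> = vertices \<Gamma>' \<and>
     (\<forall>h\<in>half_edges \<Gamma>. \<phi> (flip \<Gamma> h) = flip \<Gamma>' (\<phi> h))"

text \<open>
  Automorphisms are normalised to be the identity off \<open>half_edges\<close>, so that each
  bijection of the half-edges is counted once.
\<close>

definition Aut :: "'h graph \<Rightarrow> ('h \<Rightarrow> 'h) set" where
  "Aut \<Gamma> = {\<phi>. \<phi> permutes half_edges \<Gamma> \<and> graph_iso \<phi> \<Gamma> \<Gamma>}"

text \<open>
  Every finite graph is isomorphic to one whose half-edges are natural numbers, so the
  isomorphism classes of the latter represent all isomorphism classes.
\<close>

definition graph_isomorphic :: "(nat graph \<times> nat graph) set" where
  "graph_isomorphic =
     {(\<Gamma>, \<Gamma>'). is_graph \<Gamma> \<and> is_graph \<Gamma>' \<and> (\<exists>\<phi>. graph_iso \<phi> \<Gamma> \<Gamma>')}"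

definition G00 :: "nat graph set set" where
  "G00 = {\<Gamma>. is_graph \<Gamma>} // graph_isomorphic"

lemma equiv_graph_isomorphic: "equiv {\<Gamma>. is_graph \<Gamma>} graph_isomorphic"
proof (rule equivI)
  show "graph_isomorphic \<subseteq> {\<Gamma>. is_graph \<Gamma>} \<times> {\<Gamma>. is_graph \<Gamma>}"
    by (auto simp: graph_isomorphic_def)
  have "graph_iso id \<Gamma> \<Gamma>" for \<Gamma> :: "nat graph"
    by (simp add: graph_iso_def)
  then show "refl_on {\<Gamma>. is_graph \<Gamma>} graph_isomorphic"
    by (auto simp: refl_on_def graph_isomorphic_def)
  show "sym graph_isomorphic"
  proof (rule symI)
    fix \<Gamma> \<Gamma>' assume "(\<Gamma>, \<Gamma>') \<in> graph_isomorphic"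
    then obtain \<phi> where g: "is_graph \<Gamma>" "is_graph \<Gamma>'" and iso: "graph_iso \<phi> \<Gamma> \<Gamma>'"
      by (auto simp: graph_isomorphic_def)
    let ?\<psi> = "inv_into (half_edges \<Gamma>) \<phi>"
    have bij: "bij_betw \<phi> (half_edges \<Gamma>) (half_edges \<Gamma>')"
      and V: "(\<lambda>v. \<phi> ` v) ` vertices \<Gamma> = vertices \<Gamma>'"
      and flp: "\<And>h. h \<in> half_edges \<Gamma> \<Longrightarrow> \<phi> (flip \<Gamma> h) = flip \<Gamma>' (\<phi> h)"
      using iso by (auto simp: graph_iso_def)
    have sub: "v \<subseteq> half_edges \<Gamma>" if "v \<in> vertices \<Gamma>" for v
      using g(1) that by (auto simp: is_graph_def partition_on_def)
    have canc: "?\<psi> ` \<phi> ` v = v" if "v \<in> vertices \<Gamma>" for v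
      using inv_into_image_cancel[OF bij_betw_imp_inj_on[OF bij] sub[OF that]] .
    have "(\<lambda>v. ?\<psi> ` v) ` vertices \<Gamma>' = vertices \<Gamma>"
    proof -
      have "(\<lambda>v. ?\<psi> ` v) ` vertices \<Gamma>' = (\<lambda>v. ?\<psi> ` \<phi> ` v) ` vertices \<Gamma>"
        unfolding V[symmetric] by (rule image_image)
      also have "\<dots> = (\<lambda>v. v) ` vertices \<Gamma>"
        by (rule image_cong[OF refl canc])
      finally show ?thesis
        by simp
    qed
    moreover have "?\<psi> (flip \<Gamma>' h) = flip \<Gamma> (?\<psi> h)" if h: "h \<in> half_edges \<Gamma>'" for h
    proof -
      obtain h0 where h0: "h0 \<in> half_edges \<Gamma>" "h = \<phi> h0"
        using h bij by (auto simp: bij_betw_def)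
      then have "flip \<Gamma> h0 \<in> half_edges \<Gamma>"
        using g(1) by (auto simp: is_graph_def)
      then show ?thesis
        using h0 flp[OF h0(1)] bij_betw_imp_inj_on[OF bij] by (metis inv_into_f_f)
    qed
    ultimately have "graph_iso ?\<psi> \<Gamma>' \<Gamma>"
      using bij_betw_inv_into[OF bij] by (simp add: graph_iso_def)
    with g show "(\<Gamma>', \<Gamma>) \<in> graph_isomorphic"
      by (auto simp: graph_isomorphic_def)
  qed
  show "trans graph_isomorphic"
  proof (rule transI)
    fix \<Gamma> \<Gamma>' \<Gamma>''
    assume "(\<Gamma>, \<Gamma>') \<in> graph_isomorphic" "(\<Gamma>', \<Gamma>'') \<in> graph_isomorphic"
    then obtain \<phi> \<psi> where g: "is_graph \<Gamma>" "is_graph \<Gamma>''"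
      and iso: "graph_iso \<phi> \<Gamma> \<Gamma>'" "graph_iso \<psi> \<Gamma>' \<Gamma>''"
      by (auto simp: graph_isomorphic_def)
    have "bij_betw (\<psi> \<circ> \<phi>) (half_edges \<Gamma>) (half_edges \<Gamma>'')"
      using iso by (auto simp: graph_iso_def intro: bij_betw_trans)
    moreover have "(\<lambda>v. (\<psi> \<circ> \<phi>) ` v) ` vertices \<Gamma> = (\<lambda>v. \<psi> ` v) ` (\<lambda>v. \<phi> ` v) ` vertices \<Gamma>"
      by (simp add: image_image image_comp)
    moreover have "\<phi> h \<in> half_edges \<Gamma>'" if "h \<in> half_edges \<Gamma>" for h
      using iso(1) that by (auto simp: graph_iso_def bij_betw_def)
    ultimately have "graph_iso (\<psi> \<circ> \<phi>) \<Gamma> \<Gamma>''"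
      using iso by (auto simp: graph_iso_def)
    with g show "(\<Gamma>, \<Gamma>'') \<in> graph_isomorphic"
      by (auto simp: graph_isomorphic_def)
  qed
qed

definition edges :: "'h graph \<Rightarrow> 'h set set" where
  "edges \<Gamma> = (\<lambda>h. {h, flip \<Gamma> h}) ` half_edges \<Gamma>"

text \<open>
  The value of a graph, for vertex tensors \<open>A k\<close> with values in any commutative ring. The
  half-edges at a vertex are listed in increasing order; the order is immaterial when every
  \<open>A k\<close> is symmetric.
\<close>

definition graph_value ::
    "nat \<Rightarrow> (nat \<Rightarrow> 'v) \<Rightarrow> (nat \<Rightarrow> 'v list \<Rightarrow> 'r :: comm_ring_1) \<Rightarrow> 'h :: linorder graph \<Rightarrow> 'r" where
  "graph_value d e A \<Gamma> =
     (\<Sum>c\<in>edges \<Gamma> \<rightarrow>\<^sub>E {..<d}. \<Prod>v\<in>vertices \<Gamma>.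
        A (card v) (map (\<lambda>h. e (c {h, flip \<Gamma> h})) (sorted_list_of_set v)))"


section \<open>The two sides of the expansion\<close>

text \<open>\<open>exp (\<Sum>k\<ge>1. x\<^sub>k S\<^sub>k(v, \<dots>, v) / k!)\<close> as a formal power series in the \<open>x\<^sub>k\<close>.\<close>

definition exp_potential ::
    "(nat \<Rightarrow> 'a :: real_vector complexification list \<Rightarrow> complex) \<Rightarrow> 'a \<Rightarrow> (nat, complex) mps" where
  "exp_potential S v =
     mps_exp (formal_sum (\<lambda>k. mps_var k * mps_const (S k (replicate k (of_V v)) / fact k)) {1..})"

text \<open>The graphical calculus with vertex tensors \<open>A\<^sub>k = x\<^sub>k S\<^sub>k\<close>.\<close>

definition Z_var ::
    "nat \<Rightarrow> (nat \<Rightarrow> 'a :: real_vector) \<Rightarrow> (nat \<Rightarrow> 'a complexification list \<Rightarrow> complex)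
     \<Rightarrow> nat graph \<Rightarrow> (nat, complex) mps" where
  "Z_var d e S = graph_value d (\<lambda>i. of_V (e i)) (\<lambda>k Xs. mps_var k * mps_const (S k Xs))"

text \<open>
  The summand does not depend on the choice of representative, because it is
  isomorphism invariant when every \<open>S k\<close> is symmetric.
\<close>

definition class_term ::
    "nat \<Rightarrow> (nat \<Rightarrow> 'a :: real_vector) \<Rightarrow> (nat \<Rightarrow> 'a complexification list \<Rightarrow> complex)
     \<Rightarrow> nat graph set \<Rightarrow> (nat, complex) mps" where
  "class_term d e S C =
     (let \<Gamma> = SOME \<Gamma>. \<Gamma> \<in> C in mps_const (1 / of_nat (card (Aut \<Gamma>))) * Z_var d e S \<Gamma>)"

end

theory Submission
  imports Defs
begin

text \<open>
  The identity is checked one monomial at a time; the variable \<open>x\<^sub>0\<close> occurs on neither side.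
  Fix exponents \<open>n\<^sub>k\<close> for \<open>k \<ge> 1\<close> and put \<open>N = \<Sum>\<^sub>k k n\<^sub>k\<close>. Both coefficients of \<open>\<Prod>\<^sub>k x\<^sub>k ^ n\<^sub>k\<close> turn out to be
  \<open>1 / N!\<close> times the sum of the values of all graphs with half-edge set \<open>{..<N}\<close>
  that have \<open>n\<^sub>k\<close> vertices of valence \<open>k\<close> for every \<open>k\<close>.

  For the integral, the coefficient of the exponential is
  \<open>\<Prod>\<^sub>k (S\<^sub>k(v, \<dots>, v) / k!) ^ n\<^sub>k / n\<^sub>k!\<close>. The set \<open>{..<N}\<close> has
  \<open>N! / \<Prod>\<^sub>k (k! ^ n\<^sub>k n\<^sub>k!)\<close> partitions into \<open>n\<^sub>k\<close> blocks of size \<open>k\<close>, so this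
  coefficient is \<open>1 / N!\<close> times a sum over such partitions \<open>P\<close> of
  \<open>\<Prod>\<^bsub>B\<in>P\<^esub> S\<^bsub>|B|\<^esub>(v, \<dots>, v)\<close> (\<open>sum_partitions_prod_card\<close>). Expanding \<open>v\<close> in the
  orthonormal basis gives a sum over all maps \<open>c\<close> from \<open>{..<N}\<close> to the basis indices, with
  the monomial \<open>\<Prod>\<^sub>h (v, e\<^bsub>c(h)\<^esub>)\<close> in each term (\<open>prod_tensor_expansion\<close>). By Wick's formula
  (\<open>wick_formula\<close>) the Gaussian mean of that monomial is the number of fixed-point-free
  involutions \<open>\<sigma>\<close> of \<open>{..<N}\<close> with \<open>c \<circ> \<sigma> = c\<close>. A partition \<open>P\<close> together with such
  an involution \<open>\<sigma>\<close> is a graph on \<open>{..<N}\<close>, and the sum over the \<open>\<sigma>\<close>-invariant maps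
  \<open>c\<close> is its value.

  For the sum over graphs, the symmetric group on \<open>N\<close> letters acts on the graphs on
  \<open>{..<N}\<close>. The orbits are the isomorphism classes and the stabilisers are the automorphism
  groups, so a class contains \<open>N! / |Aut \<Gamma>|\<close> labelled graphs (\<open>card_labelled_graphs_iso\<close>),
  all with the same value because the \<open>S\<^sub>k\<close> are symmetric (\<open>graph_value_iso\<close>).

  Wick's formula is derived from translation invariance and local finiteness of \<open>dv\<close>, without
  identifying \<open>dv\<close> with Lebesgue measure. Local finiteness and compactness of balls give at most
  exponential growth of \<open>dv(B\<^sub>R)\<close> in \<open>R\<close>, hence convergence of all integrals
  \<open>\<integral> exp (c |v| - |v|\<^sup>2 / 2) dv\<close>. Differentiating an integral along a translation yields
  Stein's identity (\<open>stein_identity\<close>), that is, Gaussian integration by parts, and iterating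
  it pairs off the factors of a monomial.
\<close>

section \<open>Exponentials of linear formal power series\<close>

(* Monomials of degree 1 are written \<open>Poly_Mapping.single k 1\<close>; the simplifier has to keep the
   exponent in that form for the rules about them to apply. *)
context
  notes One_nat_def [simp del]
begin

lemma mps_coeff_zero [simp]: "mps_coeff 0 n = 0"
  by (simp add: zero_mps_def)

lemma mps_coeff_one: "mps_coeff 1 n = (if n = 0 then 1 else 0)"
  by (simp add: one_mps_def)

lemma mps_coeff_add: "mps_coeff (f + g) n = mps_coeff f n + mps_coeff g n"
  by (simp add: plus_mps_def)

lemma mps_coeff_mult:
  "mps_coeff (f * g) n = (\<Sum>(a, b)\<in>{(a, b). a + b = n}. mps_coeff f a * mps_coeff g b)"
  by (simp add: times_mps_def)

lemma mps_coeff_sum: "mps_coeff (sum f I) n = (\<Sum>i\<in>I. mps_coeff (f i) n)"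
  by (induction I rule: infinite_finite_induct) (auto simp: mps_coeff_add)

definition mps_monom :: "('x \<Rightarrow>\<^sub>0 nat) \<Rightarrow> 'c :: zero \<Rightarrow> ('x, 'c) mps" where
  "mps_monom m c = Abs_mps (\<lambda>n. if n = m then c else 0)"

lemma mps_coeff_monom: "mps_coeff (mps_monom m c) n = (if n = m then c else 0)"
  by (simp add: mps_monom_def)

lemma mps_const_eq_monom: "mps_const c = mps_monom 0 c"
  by (simp add: mps_const_def mps_monom_def)

lemma mps_var_eq_monom: "mps_var k = mps_monom (Poly_Mapping.single k 1) 1"
  by (simp add: mps_var_def mps_monom_def)

lemma mps_monom_mult: 
  "mps_monom m (c :: 'c :: comm_ring_1) * mps_monom m' c' = mps_monom (m + m') (c * c')"
proof (rule mps_eqI)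
  fix n
  have "mps_coeff (mps_monom m c * mps_monom m' c') n
      = (\<Sum>p\<in>{(a, b). a + b = n}. if p = (m, m') then c * c' else 0)"
    unfolding mps_coeff_mult by (intro sum.cong) (auto simp: mps_coeff_monom split: if_splits)
  also have "\<dots> = mps_coeff (mps_monom (m + m') (c * c')) n"
    by (auto simp: mps_coeff_monom finite_sum_eq_poly_mapping)
  finally show "mps_coeff (mps_monom m c * mps_monom m' c') n
      = mps_coeff (mps_monom (m + m') (c * c')) n" .
qed

lemma mps_coeff_const_mult:
  "mps_coeff (mps_const (c :: 'c :: comm_ring_1) * f) n = c * mps_coeff f n"
proof -
  have "mps_coeff (mps_const c * f) n
      = (\<Sum>p\<in>{(a, b). a + b = n}. if p = (0, n) then c * mps_coeff f n else 0)"
    unfolding mps_coeff_mult mps_const_eq_monom 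
    by (intro sum.cong) (auto simp: mps_coeff_monom split: if_splits)
  then show ?thesis by (simp add: finite_sum_eq_poly_mapping)
qed

lemma mps_var_times_const:
  "mps_var k * mps_const (c :: 'c :: comm_ring_1) = mps_monom (Poly_Mapping.single k 1) c"
  by (simp add: mps_var_eq_monom mps_const_eq_monom mps_monom_mult)

lemma mps_monom_prod:
  "finite I \<Longrightarrow> (\<Prod>i\<in>I. mps_monom (m i) (c i :: 'c :: comm_ring_1)) = mps_monom (\<Sum>i\<in>I. m i) (\<Prod>i\<in>I. c i)"
proof (induction I rule: finite_induct)
  case empty
  show ?case by (rule mps_eqI) (simp add: mps_coeff_monom mps_coeff_one)
next
  case (insert x F)
  then show ?case by (simp add: mps_monom_mult)
qed

definition weighted_degree :: "('x \<Rightarrow> nat) \<Rightarrow> ('x \<Rightarrow>\<^sub>0 nat) \<Rightarrow> nat" where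
  "weighted_degree w n = (\<Sum>k\<in>Poly_Mapping.keys n. w k * Poly_Mapping.lookup n k)"

lemma weighted_degree_superset:
  assumes "finite K" "Poly_Mapping.keys n \<subseteq> K"
  shows "weighted_degree w n = (\<Sum>k\<in>K. w k * Poly_Mapping.lookup n k)"
  unfolding weighted_degree_def
  by (rule sum.mono_neutral_left) (use assms in \<open>auto simp: in_keys_iff\<close>)

lemma weighted_degree_zero [simp]: "weighted_degree w 0 = 0"
  by (simp add: weighted_degree_def)

lemma weighted_degree_single [simp]: "weighted_degree w (Poly_Mapping.single k 1) = w k"
  by (simp add: weighted_degree_def)

lemma weighted_degree_add: "weighted_degree w (m + n) = weighted_degree w m + weighted_degree w n"
proof -
  let ?K = "Poly_Mapping.keys m \<union> Poly_Mapping.keys n"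
  have "weighted_degree w (m + n) = (\<Sum>k\<in>?K. w k * Poly_Mapping.lookup (m + n) k)"
    by (rule weighted_degree_superset) (use Poly_Mapping.keys_add[of m n] in auto)
  also have "\<dots> = (\<Sum>k\<in>?K. w k * Poly_Mapping.lookup m k) + (\<Sum>k\<in>?K. w k * Poly_Mapping.lookup n k)"
    by (simp add: lookup_add algebra_simps sum.distrib)
  also have "\<dots> = weighted_degree w m + weighted_degree w n"
    by (intro arg_cong2[where f = "(+)"] weighted_degree_superset[symmetric]) auto
  finally show ?thesis .
qed

lemma keys_eq_single_add:
  fixes n :: "'x \<Rightarrow>\<^sub>0 nat"
  assumes "k \<in> Poly_Mapping.keys n"
  shows "Poly_Mapping.single k 1 + (n - Poly_Mapping.single k 1) = n"
  using assms
  by (intro poly_mapping_eqI) (auto simp: lookup_add lookup_minus lookup_single when_def in_keys_iff)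

text \<open>
  The coefficient of the monomial \<open>n\<close> in \<open>exp (\<Sum>\<^sub>k x\<^sub>k a\<^sub>k)\<close>, see \<open>mps_coeff_exp_linear_series\<close>.
\<close>

definition exp_coeff :: "('x \<Rightarrow> 'c :: field_char_0) \<Rightarrow> ('x \<Rightarrow>\<^sub>0 nat) \<Rightarrow> 'c" where
  "exp_coeff a n = (\<Prod>k\<in>Poly_Mapping.keys n. a k ^ Poly_Mapping.lookup n k / fact (Poly_Mapping.lookup n k))"

lemma exp_coeff_superset:
  assumes "finite K" "Poly_Mapping.keys n \<subseteq> K"
  shows "exp_coeff a n = (\<Prod>k\<in>K. a k ^ Poly_Mapping.lookup n k / fact (Poly_Mapping.lookup n k))"
  unfolding exp_coeff_def
  by (rule prod.mono_neutral_left) (use assms in \<open>auto simp: in_keys_iff\<close>)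

text \<open>
  This is the relation \<open>\<partial>E / \<partial>x\<^sub>k = a\<^sub>k E\<close> for \<open>E = exp (\<Sum>\<^sub>k x\<^sub>k a\<^sub>k)\<close>, read off at the
  monomial \<open>n / x\<^sub>k\<close>.
\<close>

lemma exp_coeff_diff_single:
  assumes k: "k \<in> Poly_Mapping.keys n"
  shows "a k * exp_coeff a (n - Poly_Mapping.single k 1) = of_nat (Poly_Mapping.lookup n k) * exp_coeff a n"
proof -
  let ?t = "\<lambda>m j. a j ^ Poly_Mapping.lookup m j / fact (Poly_Mapping.lookup m j)"
  let ?n' = "n - Poly_Mapping.single k 1"
  have sub: "Poly_Mapping.keys ?n' \<subseteq> Poly_Mapping.keys n"
    by (auto simp: in_keys_iff lookup_minus)
  have "exp_coeff a ?n' = (\<Prod>j\<in>Poly_Mapping.keys n. ?t ?n' j)"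
    by (rule exp_coeff_superset[OF _ sub]) simp
  also have "\<dots> = ?t ?n' k * (\<Prod>j\<in>Poly_Mapping.keys n - {k}. ?t ?n' j)"
    by (rule prod.remove) (use k in auto)
  also have "(\<Prod>j\<in>Poly_Mapping.keys n - {k}. ?t ?n' j) = (\<Prod>j\<in>Poly_Mapping.keys n - {k}. ?t n j)"
    by (intro prod.cong) (auto simp: lookup_minus lookup_single when_def)
  finally have 1: "exp_coeff a ?n' = ?t ?n' k * (\<Prod>j\<in>Poly_Mapping.keys n - {k}. ?t n j)" .
  have 2: "exp_coeff a n = ?t n k * (\<Prod>j\<in>Poly_Mapping.keys n - {k}. ?t n j)"
    unfolding exp_coeff_def by (rule prod.remove) (use k in auto)
  obtain i where i: "Poly_Mapping.lookup n k = Suc i"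
    using k by (cases "Poly_Mapping.lookup n k") (auto simp: in_keys_iff)
  have "a k * ?t ?n' k = of_nat (Poly_Mapping.lookup n k) * ?t n k"
    by (simp add: i lookup_minus lookup_single field_simps del: of_nat_Suc)
  then show ?thesis
    by (simp only: 1 2 mult.assoc[symmetric])
qed

text \<open>
  The Euler operator \<open>\<Sum>\<^sub>k w\<^sub>k x\<^sub>k \<partial>/\<partial>x\<^sub>k\<close> multiplies a monomial by its weighted degree.
  The weight 1 drives the induction over powers of a linear series, and the weight \<open>k\<close> of
  \<open>x\<^sub>k\<close> drives the count of partitions.
\<close>

lemma sum_exp_coeff_diff_single:
  "(\<Sum>k\<in>Poly_Mapping.keys n. of_nat (w k) * (a k * exp_coeff a (n - Poly_Mapping.single k 1)))
    = of_nat (weighted_degree w n) * exp_coeff a n"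
proof -
  have "of_nat (w k) * (a k * exp_coeff a (n - Poly_Mapping.single k 1))
      = of_nat (w k * Poly_Mapping.lookup n k) * exp_coeff a n" if "k \<in> Poly_Mapping.keys n" for k
    by (simp add: exp_coeff_diff_single[OF that] mult.assoc)
  then show ?thesis
    by (simp only: weighted_degree_def sum_distrib_right of_nat_sum cong: sum.cong)
qed

definition linear_series :: "(nat \<Rightarrow> 'c) \<Rightarrow> (nat, 'c :: comm_ring_1) mps" where
  "linear_series a = formal_sum (\<lambda>k. mps_var k * mps_const (a k)) {1..}"

lemma single_one_eq_iff [simp]:
  "Poly_Mapping.single j (1 :: nat) = Poly_Mapping.single k 1 \<longleftrightarrow> j = k"
  by (metis keys_single one_neq_zero singleton_inject)

lemma linear_series_coeff:
  assumes "a 0 = 0"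
  shows "mps_coeff (linear_series a) (Poly_Mapping.single k 1) = a k"
    and "(\<And>k. m \<noteq> Poly_Mapping.single k 1) \<Longrightarrow> mps_coeff (linear_series a) m = 0"
proof -
  have k: "1 \<le> k" if "a k \<noteq> 0"
    using assms that by (cases k) auto
  have "{j \<in> {1..}. mps_coeff (mps_var j * mps_const (a j)) (Poly_Mapping.single k 1) \<noteq> 0}
      = (if a k = 0 then {} else {k})"
    using k by (auto simp: mps_var_times_const mps_coeff_monom split: if_splits)
  then show "mps_coeff (linear_series a) (Poly_Mapping.single k 1) = a k"
    by (simp add: linear_series_def formal_sum_def mps_var_times_const mps_coeff_monom)
  show "mps_coeff (linear_series a) m = 0" if "\<And>k. m \<noteq> Poly_Mapping.single k 1"
    using that by (simp add: linear_series_def formal_sum_def mps_var_times_const mps_coeff_monom)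
qed

lemma mps_coeff_linear_series_mult:
  assumes "a 0 = 0"
  shows "mps_coeff (linear_series a * g) n
    = (\<Sum>k\<in>Poly_Mapping.keys n. a k * mps_coeff g (n - Poly_Mapping.single k 1))"
proof -
  let ?h = "\<lambda>k. (Poly_Mapping.single k 1, n - Poly_Mapping.single k 1)"
  have "mps_coeff (linear_series a * g) n
      = (\<Sum>(p, q)\<in>?h ` Poly_Mapping.keys n. mps_coeff (linear_series a) p * mps_coeff g q)"
    unfolding mps_coeff_mult
  proof (rule sum.mono_neutral_right)
    show "?h ` Poly_Mapping.keys n \<subseteq> {(p, q). p + q = n}"
      by (auto simp: keys_eq_single_add)
    show "\<forall>x\<in>{(p, q). p + q = n} - ?h ` Poly_Mapping.keys n.
        (case x of (p, q) \<Rightarrow> mps_coeff (linear_series a) p * mps_coeff g q) = 0"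
    proof
      fix z assume z: "z \<in> {(p, q). p + q = n} - ?h ` Poly_Mapping.keys n"
      obtain p q where [simp]: "z = (p, q)"
        by (cases z)
      have pq: "(p, q) \<notin> ?h ` Poly_Mapping.keys (p + q)" "n = p + q"
        using z by auto
      have "p \<noteq> Poly_Mapping.single k 1" for k
      proof
        assume p: "p = Poly_Mapping.single k 1"
        then have "k \<in> Poly_Mapping.keys (p + q)"
          by (simp add: in_keys_iff lookup_add)
        moreover have "(p, q) = (Poly_Mapping.single k 1, p + q - Poly_Mapping.single k 1)"
          by (simp add: p)
        ultimately show False
          using pq by blast
      qed
      then show "(case z of (p, q) \<Rightarrow> mps_coeff (linear_series a) p * mps_coeff g q) = 0"
        by (simp add: linear_series_coeff(2)[of a, OF assms])
    qed
  qed (simp add: finite_sum_eq_poly_mapping)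
  also have "\<dots> = (\<Sum>k\<in>Poly_Mapping.keys n. a k * mps_coeff g (n - Poly_Mapping.single k 1))"
    by (subst sum.reindex)
      (auto simp: inj_on_def linear_series_coeff(1)[of a, OF assms])
  finally show ?thesis .
qed

text \<open>
  Among the powers of a linear series only the one whose exponent is the total degree of \<open>n\<close>
  contributes to the monomial \<open>n\<close>. The recursion in the exponent is the Euler relation with
  weight 1.
\<close>

lemma mps_coeff_linear_series_power:
  assumes "a 0 = 0"
  shows "mps_coeff (linear_series a ^ j) n
    = (if weighted_degree (\<lambda>_. 1) n = j then fact j * exp_coeff a n else 0)"
proof (induction j arbitrary: n)
  case 0
  have "weighted_degree (\<lambda>_. 1) n = 0 \<longleftrightarrow> n = 0"
    by (auto simp: weighted_degree_def simp flip: keys_eq_empty)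
  then show ?case
    by (auto simp: mps_coeff_one exp_coeff_def)
next
  case (Suc j)
  have deg: "weighted_degree (\<lambda>_. 1) n = Suc (weighted_degree (\<lambda>_. 1) (n - Poly_Mapping.single k 1))"
    if "k \<in> Poly_Mapping.keys n" for k
    using weighted_degree_add[of "\<lambda>_. 1" "Poly_Mapping.single k 1" "n - Poly_Mapping.single k 1"]
    unfolding keys_eq_single_add[OF that] by simp
  have "mps_coeff (linear_series a ^ Suc j) n
      = (\<Sum>k\<in>Poly_Mapping.keys n. a k * mps_coeff (linear_series a ^ j) (n - Poly_Mapping.single k 1))"
    by (simp add: mps_coeff_linear_series_mult[of a, OF assms])
  also have "\<dots> = (\<Sum>k\<in>Poly_Mapping.keys n. if weighted_degree (\<lambda>_. 1) n = Suc j
      then fact j * (of_nat 1 * (a k * exp_coeff a (n - Poly_Mapping.single k 1))) else 0)"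
    by (intro sum.cong) (auto simp: Suc.IH deg)
  also have "\<dots> = (if weighted_degree (\<lambda>_. 1) n = Suc j then fact (Suc j) * exp_coeff a n else 0)"
  proof (cases "weighted_degree (\<lambda>_. 1) n = Suc j")
    case True
    then show ?thesis
      using sum_exp_coeff_diff_single[of "\<lambda>_. 1" a n]
      by (simp flip: sum_distrib_left)
  qed simp
  finally show ?case .
qed

lemma mps_coeff_exp_linear_series:
  assumes "a 0 = 0"
  shows "mps_coeff (mps_exp (linear_series a)) n = exp_coeff a n"
proof -
  let ?c = "\<lambda>j. mps_coeff (mps_const (1 / fact j) * linear_series a ^ j) n"
  let ?N = "weighted_degree (\<lambda>_. 1) n"
  have c: "?c j = (if j = ?N then exp_coeff a n else 0)" for j
    unfolding mps_coeff_const_mult mps_coeff_linear_series_power[of a, OF assms] by simp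
  have "mps_coeff (mps_exp (linear_series a)) n = (\<Sum>j\<in>{j \<in> UNIV. ?c j \<noteq> 0}. ?c j)"
    unfolding mps_exp_def formal_sum_def by (rule mps_coeff_Abs[THEN fun_cong])
  also have "\<dots> = (\<Sum>j\<in>{?N}. ?c j)"
    unfolding c by (rule sum.mono_neutral_left) auto
  finally show ?thesis unfolding c by simp
qed

end

section \<open>Pairings of a finite set\<close>

text \<open>
  A perfect matching is encoded as the involution exchanging partners. It is the identity
  off \<open>H\<close>, so that distinct matchings are distinct functions and \<open>pairings H\<close> is finite.
\<close>

definition pairings :: "'h set \<Rightarrow> ('h \<Rightarrow> 'h) set" where
  "pairings H = {\<sigma>. (\<forall>h. h \<notin> H \<longrightarrow> \<sigma> h = h) \<and> (\<forall>h\<in>H. \<sigma> h \<in> H \<and> \<sigma> (\<sigma> h) = h \<and> \<sigma> h \<noteq> h)}"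

lemma finite_pairings: "finite H \<Longrightarrow> finite (pairings H)"
proof (rule finite_subset)
  show "pairings H \<subseteq> {\<sigma>. \<sigma> permutes H}"
    by (auto simp: pairings_def permutes_def) metis+
qed (rule finite_permutations)

lemma pairings_empty [simp]: "pairings {} = {id}"
  by (auto simp: pairings_def)

text \<open>
  A pairing is determined by the partner \<open>h\<close> of a chosen element \<open>h\<^sub>0\<close> and a pairing of the
  remaining elements. Stein's identity produces the same recursion.
\<close>

lemma sum_pairings_remove:
  assumes "finite H" "h\<^sub>0 \<in> H"
  shows "(\<Sum>\<sigma>\<in>pairings H. F \<sigma>)
    = (\<Sum>h\<in>H - {h\<^sub>0}. \<Sum>\<tau>\<in>pairings (H - {h\<^sub>0} - {h}). F (\<tau>(h\<^sub>0 := h, h := h\<^sub>0)))"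
proof -
  have "(\<Sum>h\<in>H - {h\<^sub>0}. \<Sum>\<tau>\<in>pairings (H - {h\<^sub>0} - {h}). F (\<tau>(h\<^sub>0 := h, h := h\<^sub>0)))
      = (\<Sum>(h, \<tau>)\<in>(SIGMA h:H - {h\<^sub>0}. pairings (H - {h\<^sub>0} - {h})). F (\<tau>(h\<^sub>0 := h, h := h\<^sub>0)))"
    using assms by (intro sum.Sigma) (auto intro: finite_pairings)
  also have "\<dots> = (\<Sum>\<sigma>\<in>pairings H. F \<sigma>)"
  proof (rule sum.reindex_bij_witness[where
        i = "\<lambda>\<sigma>. (\<sigma> h\<^sub>0, \<sigma>(h\<^sub>0 := h\<^sub>0, \<sigma> h\<^sub>0 := \<sigma> h\<^sub>0))" and j = "\<lambda>(h, \<tau>). \<tau>(h\<^sub>0 := h, h := h\<^sub>0)"])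
    fix p assume "p \<in> (SIGMA h:H - {h\<^sub>0}. pairings (H - {h\<^sub>0} - {h}))"
    then obtain h \<tau> where p: "p = (h, \<tau>)" "h \<in> H" "h \<noteq> h\<^sub>0" and \<tau>: "\<tau> \<in> pairings (H - {h\<^sub>0} - {h})"
      by auto
    have "\<tau> h\<^sub>0 = h\<^sub>0" "\<tau> h = h"
      using \<tau> by (auto simp: pairings_def)
    then show "(\<lambda>\<sigma>. (\<sigma> h\<^sub>0, \<sigma>(h\<^sub>0 := h\<^sub>0, \<sigma> h\<^sub>0 := \<sigma> h\<^sub>0))) (case p of (h, \<tau>) \<Rightarrow> \<tau>(h\<^sub>0 := h, h := h\<^sub>0)) = p"
      using p by (auto simp: fun_eq_iff)
    show "(case p of (h, \<tau>) \<Rightarrow> \<tau>(h\<^sub>0 := h, h := h\<^sub>0)) \<in> pairings H"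
      using p \<tau> assms by (auto simp: pairings_def)
    show "F (case p of (h, \<tau>) \<Rightarrow> \<tau>(h\<^sub>0 := h, h := h\<^sub>0)) = (case p of (h, \<tau>) \<Rightarrow> F (\<tau>(h\<^sub>0 := h, h := h\<^sub>0)))"
      by (simp add: p)
  next
    fix \<sigma> assume \<sigma>: "\<sigma> \<in> pairings H"
    show "(case (\<sigma> h\<^sub>0, \<sigma>(h\<^sub>0 := h\<^sub>0, \<sigma> h\<^sub>0 := \<sigma> h\<^sub>0)) of (h, \<tau>) \<Rightarrow> \<tau>(h\<^sub>0 := h, h := h\<^sub>0)) = \<sigma>"
      using \<sigma> assms(2) by (auto simp: pairings_def fun_eq_iff)
    have inj: "\<sigma> x = \<sigma> y \<Longrightarrow> x = y" for x y
      using \<sigma> unfolding pairings_def mem_Collect_eq by metis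
    show "(\<sigma> h\<^sub>0, \<sigma>(h\<^sub>0 := h\<^sub>0, \<sigma> h\<^sub>0 := \<sigma> h\<^sub>0)) \<in> (SIGMA h:H - {h\<^sub>0}. pairings (H - {h\<^sub>0} - {h}))"
      using \<sigma> assms(2) by (auto simp: pairings_def dest: inj)
  qed
  finally show ?thesis ..
qed


section \<open>Gaussian integrals over translation-invariant measures\<close>

definition gauss_weight :: "'a :: real_inner \<Rightarrow> real" where
  "gauss_weight v = exp (- (1/2) * (v \<bullet> v))"

lemma gauss_weight_pos: "gauss_weight v > 0"
  by (simp add: gauss_weight_def)

lemma continuous_gauss_weight: "continuous_on UNIV gauss_weight"
  unfolding gauss_weight_def by (intro continuous_intros)

definition linear_product :: "('b \<Rightarrow> 'a :: real_inner) \<Rightarrow> 'b set \<Rightarrow> 'a \<Rightarrow> real" where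
  "linear_product a H v = (\<Prod>h\<in>H. v \<bullet> a h)"

lemma continuous_linear_product: "continuous_on UNIV (linear_product a H)"
  unfolding linear_product_def by (intro continuous_intros)

lemma abs_linear_product_le:
  assumes "\<And>h. h \<in> H \<Longrightarrow> norm (a h) = 1" "norm v \<le> r"
  shows "\<bar>linear_product a H v\<bar> \<le> r ^ card H"
proof -
  have "\<bar>linear_product a H v\<bar> = (\<Prod>h\<in>H. \<bar>v \<bullet> a h\<bar>)"
    by (simp add: linear_product_def abs_prod)
  also have "\<dots> \<le> (\<Prod>h\<in>H. r)"
    using assms Cauchy_Schwarz_ineq2[of v "a _"] by (intro prod_mono conjI) (force intro: order_trans)+
  finally show ?thesis
    by simp
qed

lemma power_norm_le_exp: "0 \<le> norm v + 1 \<and> (norm (v :: 'a :: real_normed_vector) + 1) ^ n \<le> exp (real n * norm v)"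
  using exp_ge_add_one_self[of "norm v"] by (auto simp: exp_of_nat_mult add.commute intro!: power_mono)

context
  fixes d :: nat and e :: "nat \<Rightarrow> 'a :: real_inner"
  assumes basis: "orthonormal_basis d e"
begin

lemma inner_basis: "i < d \<Longrightarrow> j < d \<Longrightarrow> e i \<bullet> e j = (if i = j then 1 else 0)"
  using basis by (simp add: orthonormal_basis_def)

lemma norm_basis: "i < d \<Longrightarrow> norm (e i) = 1"
  by (simp add: norm_eq_sqrt_inner inner_basis)

text \<open>
  Both sides are linear in \<open>v\<close> and agree on the basis vectors, which span.
\<close>

lemma basis_expansion: "(\<Sum>i<d. (v \<bullet> e i) *\<^sub>R e i) = v"
proof -
  have "v \<in> span (e ` {..<d})"
    using basis by (simp add: orthonormal_basis_def)
  then show ?thesis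
  proof (induction rule: span_induct)
    show "subspace {v. (\<Sum>i<d. (v \<bullet> e i) *\<^sub>R e i) = v}"
      by (auto simp: subspace_def inner_add_left scaleR_add_left sum.distrib
          simp flip: scaleR_sum_right scaleR_scaleR)
    show "(\<Sum>i<d. (v \<bullet> e i) *\<^sub>R e i) = v" if v: "v \<in> e ` {..<d}" for v
    proof -
      obtain j where j: "j < d" "v = e j"
        using v by auto
      have "(\<Sum>i<d. (v \<bullet> e i) *\<^sub>R e i) = (\<Sum>i<d. if j = i then e i else 0)"
        using j by (intro sum.cong) (auto simp: inner_basis)
      then show ?thesis
        using j by simp
    qed
  qed
qed

text \<open>
  The cube of side \<open>2 r\<close> spanned by the basis is a sum of compact segments, hence compact, and
  contains the ball.
\<close>

lemma compact_cball_of_basis: "compact (cball (0 :: 'a) r)"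
proof -
  have "\<exists>K. compact K \<and> (\<forall>x. (\<forall>i<n. \<bar>x i\<bar> \<le> r) \<longrightarrow> (\<Sum>i<n. x i *\<^sub>R e i) \<in> K)" for n
  proof (induction n)
    case 0
    show ?case
      by (intro exI[of _ "{0}"]) simp
  next
    case (Suc n)
    then obtain K where K: "compact K" "\<And>x. (\<forall>i<n. \<bar>x i\<bar> \<le> r) \<Longrightarrow> (\<Sum>i<n. x i *\<^sub>R e i) \<in> K"
      by blast
    let ?L = "(\<lambda>t. t *\<^sub>R e n) ` {- r..r}"
    have "compact ?L"
      by (intro compact_continuous_image continuous_intros compact_Icc)
    then have "compact {a + b | a b. a \<in> K \<and> b \<in> ?L}"
      by (rule compact_sums[OF K(1)])
    moreover have "(\<Sum>i<Suc n. x i *\<^sub>R e i) \<in> {a + b | a b. a \<in> K \<and> b \<in> ?L}"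
      if x: "\<forall>i<Suc n. \<bar>x i\<bar> \<le> r" for x
    proof -
      have "(\<Sum>i<n. x i *\<^sub>R e i) \<in> K"
        using x by (intro K(2)) auto
      moreover have "x n *\<^sub>R e n \<in> ?L"
        using x by (auto simp: abs_le_iff intro!: imageI)
      ultimately show ?thesis
        unfolding sum.lessThan_Suc by blast
    qed
    ultimately show ?case
      by blast
  qed
  then obtain K where K: "compact K" "\<And>x. (\<forall>i<d. \<bar>x i\<bar> \<le> r) \<Longrightarrow> (\<Sum>i<d. x i *\<^sub>R e i) \<in> K"
    by blast
  have "cball 0 r \<subseteq> K"
  proof
    fix v :: 'a assume "v \<in> cball 0 r"
    then have "\<bar>v \<bullet> e i\<bar> \<le> r" if "i < d" for i
      using Cauchy_Schwarz_ineq2[of v "e i"] norm_basis[OF that] by auto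
    then have "(\<Sum>i<d. (v \<bullet> e i) *\<^sub>R e i) \<in> K"
      by (intro K(2)) blast
    then show "v \<in> K"
      by (simp add: basis_expansion)
  qed
  then have "cball 0 r = K \<inter> cball 0 r"
    by blast
  then show ?thesis
    using compact_Int_closed[OF K(1) closed_cball] by metis
qed

context
  fixes dv :: "'a measure"
  assumes dv: "translation_invariant_measure dv"
begin

lemma sets_dv [measurable_cong]: "sets dv = sets borel"
  and distr_dv: "distr dv borel (\<lambda>v. a + v) = dv"
  and emeasure_dv_compact: "compact K \<Longrightarrow> emeasure dv K < \<infinity>"
  and emeasure_dv_UNIV: "emeasure dv UNIV \<noteq> 0"
  using dv by (auto simp: translation_invariant_measure_def)

lemma space_dv [simp]: "space dv = UNIV"
  using sets_eq_imp_space_eq[OF sets_dv] by simp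

lemma borel_measurable_continuous_dv:
  fixes g :: "'a \<Rightarrow> 'b :: topological_space"
  shows "continuous_on UNIV g \<Longrightarrow> g \<in> borel_measurable dv"
  using borel_measurable_continuous_onI[of g] measurable_cong_sets[OF sets_dv refl] by blast

lemma emeasure_dv_translate:
  assumes "A \<in> sets borel"
  shows "emeasure dv ((\<lambda>v. c + v) ` A) = emeasure dv A"
proof -
  have "(\<lambda>v. - c + v) -` A = (\<lambda>v. c + v) ` A"
    by (force simp: image_iff)
  moreover have "emeasure dv A = emeasure dv ((\<lambda>v. - c + v) -` A \<inter> space dv)"
    by (subst distr_dv[of "- c", symmetric], subst emeasure_distr)
      (auto intro!: borel_measurable_continuous_dv continuous_intros assms)
  ultimately show ?thesis
    by simp
qed

text \<open>
  Finitely many, say \<open>N\<close>, translates of the unit ball cover the ball of radius 2. For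
  \<open>r \<ge> 1\<close> the same centres give \<open>N\<close> translates of the ball of radius \<open>r\<close> that cover the
  ball of radius \<open>r + 1\<close>, so increasing the radius by 1 multiplies the measure by at most
  \<open>N\<close>.
\<close>

lemma emeasure_dv_cball_growth:
  "\<exists>N. \<forall>n. emeasure dv (cball 0 (real n + 1)) \<le> of_nat (N ^ n) * emeasure dv (cball 0 1)"
proof -
  have "cball (0 :: 'a) 2 \<subseteq> (\<Union>c\<in>UNIV. ball c 1)"
    by auto (metis dist_self zero_less_one)
  then obtain F where F: "finite F" "cball (0 :: 'a) 2 \<subseteq> (\<Union>c\<in>F. ball c 1)"
    using compactE_image[OF compact_cball_of_basis[of 2], of UNIV "\<lambda>c. ball c 1"] by auto
  have cover: "cball 0 (r + 1) \<subseteq> (\<Union>c\<in>F. (\<lambda>v. c + v) ` cball 0 r)" if r: "r \<ge> 1" for r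
  proof
    fix v :: 'a assume v: "v \<in> cball 0 (r + 1)"
    \<comment> \<open>Split \<open>v\<close> along its own direction into parts of length at most \<open>2\<close> and \<open>r - 1\<close>; the first part is within 1 of a centre.\<close>
    define u where "u = (2 / (r + 1)) *\<^sub>R v"
    have "norm u = 2 / (r + 1) * norm v"
      using r by (simp add: u_def)
    also have "\<dots> \<le> 2 / (r + 1) * (r + 1)"
      using v r by (intro mult_left_mono) auto
    also have "\<dots> = 2"
      using r by (simp add: field_simps)
    finally have "norm u \<le> 2" .
    then have "u \<in> (\<Union>c\<in>F. ball c 1)"
      by (intro subsetD[OF F(2)]) simp
    then obtain c where c: "c \<in> F" "dist c u < 1"
      by auto
    have "v - u = ((r - 1) / (r + 1)) *\<^sub>R v"
    proof -
      have "(r - 1) / (r + 1) = 1 - 2 / (r + 1)"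
        using r by (simp add: field_simps)
      then show ?thesis
        by (simp only: u_def scaleR_left_diff_distrib scaleR_one)
    qed
    then have "norm (v - u) = (r - 1) / (r + 1) * norm v"
      using r by simp
    also have "\<dots> \<le> (r - 1) / (r + 1) * (r + 1)"
      using v r by (intro mult_left_mono) auto
    also have "\<dots> = r - 1"
      using r by (simp add: field_simps)
    finally have "norm (v - u) \<le> r - 1" .
    moreover have "norm (v - c) \<le> norm (v - u) + norm (u - c)"
      using norm_triangle_ineq[of "v - u" "u - c"] by simp
    ultimately have "norm (v - c) \<le> r"
      using c(2) by (simp add: dist_norm norm_minus_commute)
    then have "c + (v - c) \<in> (\<lambda>v. c + v) ` cball 0 r"
      by (intro imageI) simp
    then show "v \<in> (\<Union>c\<in>F. (\<lambda>v. c + v) ` cball 0 r)"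
      using c(1) by auto
  qed
  have tr: "(\<lambda>v. c + v) ` cball 0 r = cball c r" for c :: 'a and r
    by (simp add: cball_translation[of c 0 r, simplified])
  have step: "emeasure dv (cball 0 (r + 1)) \<le> of_nat (card F) * emeasure dv (cball 0 r)"
    if r: "r \<ge> 1" for r
  proof -
    have "emeasure dv (cball 0 (r + 1)) \<le> emeasure dv (\<Union>c\<in>F. (\<lambda>v. c + v) ` cball 0 r)"
      by (rule emeasure_mono[OF cover[OF r]]) (auto simp: tr sets_dv intro!: sets.finite_UN F(1))
    also have "\<dots> \<le> (\<Sum>c\<in>F. emeasure dv ((\<lambda>v. c + v) ` cball 0 r))"
      by (rule emeasure_subadditive_finite) (auto simp: tr sets_dv F(1))
    also have "\<dots> = (\<Sum>c\<in>F. emeasure dv (cball 0 r))"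
      by (intro sum.cong refl emeasure_dv_translate) simp
    also have "\<dots> = of_nat (card F) * emeasure dv (cball 0 r)"
      by simp
    finally show ?thesis .
  qed
  have "emeasure dv (cball 0 (real n + 1)) \<le> of_nat (card F ^ n) * emeasure dv (cball 0 1)" for n
  proof (induction n)
    case (Suc n)
    have "emeasure dv (cball 0 (real (Suc n) + 1)) \<le> of_nat (card F) * emeasure dv (cball 0 (real n + 1))"
      using step[of "real n + 1"] by (simp add: add_ac)
    also have "\<dots> \<le> of_nat (card F) * (of_nat (card F ^ n) * emeasure dv (cball 0 1))"
      by (intro mult_left_mono Suc.IH) simp
    finally show ?case
      by (simp add: mult_ac)
  qed simp
  then show ?thesis
    by blast
qed

text \<open>
  On the shell \<open>n \<le> |v| \<le> n + 1\<close> the integrand is at most \<open>exp (c (n + 1) - n\<^sup>2 / 2)\<close>, which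
  beats the bound \<open>N ^ n\<close> for the growth of the measure.
\<close>

lemma nn_integral_exp_norm_gaussian:
  fixes c :: real
  assumes "c \<ge> 0"
  shows "(\<integral>\<^sup>+v. ennreal (exp (c * norm v - (norm v)\<^sup>2 / 2)) \<partial>dv) < \<infinity>"
proof -
  obtain N where N: "\<And>n. emeasure dv (cball 0 (real n + 1)) \<le> of_nat (N ^ n) * emeasure dv (cball 0 1)"
    using emeasure_dv_cball_growth by blast
  let ?m = "emeasure dv (cball 0 1)"
  define t where "t n = exp (c * (real n + 1) - (real n)\<^sup>2 / 2)" for n
  \<comment> \<open>Since \<open>N \<le> exp N\<close>, completing the square in \<open>(c + N) n - n\<^sup>2 / 2\<close> with this \<open>b\<close> bounds the shell terms by a geometric series.\<close>
  define b where "b = c + real N + 1"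
  have "(\<integral>\<^sup>+v. ennreal (exp (c * norm v - (norm v)\<^sup>2 / 2)) \<partial>dv)
      \<le> (\<integral>\<^sup>+v. suminf (\<lambda>n. ennreal (t n) * indicator (cball 0 (real n + 1)) v) \<partial>dv)"
  proof (rule nn_integral_mono)
    fix v :: 'a
    define n where "n = nat \<lfloor>norm v\<rfloor>"
    have n: "real n \<le> norm v" "norm v \<le> real n + 1"
      using floor_correct[of "norm v"] by (simp_all add: n_def)
    have "c * norm v - (norm v)\<^sup>2 / 2 \<le> c * (real n + 1) - (real n)\<^sup>2 / 2"
      using n assms by (intro diff_mono mult_left_mono divide_right_mono power_mono) auto
    then have "ennreal (exp (c * norm v - (norm v)\<^sup>2 / 2)) \<le> ennreal (t n) * indicator (cball 0 (real n + 1)) v"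
      using n(2) by (simp add: t_def ennreal_leI)
    also have "\<dots> \<le> suminf (\<lambda>n. ennreal (t n) * indicator (cball 0 (real n + 1)) v)"
    proof -
      define g where "g = (\<lambda>i. ennreal (t i) * indicator (cball 0 (real i + 1)) v)"
      have "g n \<le> suminf g"
        using sum_le_suminf[of g "{n}"] by simp
      then show ?thesis
        unfolding g_def .
    qed
    finally show "ennreal (exp (c * norm v - (norm v)\<^sup>2 / 2))
        \<le> suminf (\<lambda>n. ennreal (t n) * indicator (cball 0 (real n + 1)) v)" .
  qed
  also have "\<dots> = suminf (\<lambda>n. \<integral>\<^sup>+v. ennreal (t n) * indicator (cball 0 (real n + 1)) v \<partial>dv)"
    by (intro nn_integral_suminf borel_measurable_times_ennreal borel_measurable_const
        borel_measurable_indicator) (simp add: sets_dv)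
  also have "\<dots> = suminf (\<lambda>n. ennreal (t n) * emeasure dv (cball 0 (real n + 1)))"
    by (simp add: nn_integral_cmult_indicator sets_dv)
  also have "\<dots> \<le> suminf (\<lambda>n. ennreal (exp (c + b\<^sup>2 / 2) * exp (- 1) ^ n) * ?m)"
  proof (rule suminf_le)
    fix n
    have "real N ^ n \<le> exp (real N) ^ n"
      using exp_ge_add_one_self[of "real N"] by (intro power_mono) linarith+
    then have "t n * real (N ^ n) \<le> t n * exp (real N * real n)"
      by (simp add: t_def exp_of_nat_mult[symmetric] mult.commute)
    also have "\<dots> = exp (c + (c + real N) * real n - (real n)\<^sup>2 / 2)"
      by (simp add: t_def exp_add[symmetric] algebra_simps)
    also have "\<dots> \<le> exp (c + b\<^sup>2 / 2 - real n)"
    proof -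
      have "b * real n \<le> b\<^sup>2 / 2 + (real n)\<^sup>2 / 2"
        using zero_le_power2[of "b - real n"] by (simp add: power2_diff field_simps)
      moreover have "(c + real N) * real n = b * real n - real n"
        by (simp add: b_def algebra_simps)
      ultimately show ?thesis
        by simp
    qed
    also have "\<dots> = exp (c + b\<^sup>2 / 2) * exp (- 1) ^ n"
      by (simp flip: exp_of_nat_mult exp_add)
    finally have *: "t n * real (N ^ n) \<le> exp (c + b\<^sup>2 / 2) * exp (- 1) ^ n" .
    have "ennreal (t n) * emeasure dv (cball 0 (real n + 1)) \<le> ennreal (t n) * (of_nat (N ^ n) * ?m)"
      by (intro mult_left_mono N) simp
    also have "\<dots> = ennreal (t n * real (N ^ n)) * ?m"
      by (simp add: t_def ennreal_mult ennreal_of_nat_eq_real_of_nat mult_ac)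
    also have "\<dots> \<le> ennreal (exp (c + b\<^sup>2 / 2) * exp (- 1) ^ n) * ?m"
      by (intro mult_right_mono ennreal_leI *) simp
    finally show "ennreal (t n) * emeasure dv (cball 0 (real n + 1))
        \<le> ennreal (exp (c + b\<^sup>2 / 2) * exp (- 1) ^ n) * ?m" .
  qed auto
  also have "\<dots> = suminf (\<lambda>n. ennreal (exp (c + b\<^sup>2 / 2) * exp (- 1) ^ n)) * ?m"
    by (rule ennreal_suminf_multc)
  also have "\<dots> < \<infinity>"
  proof -
    have "summable (\<lambda>n. exp (c + b\<^sup>2 / 2) * exp (- 1 :: real) ^ n)"
      by (intro summable_mult summable_geometric) simp
    then have "suminf (\<lambda>n. ennreal (exp (c + b\<^sup>2 / 2) * exp (- 1) ^ n)) < \<infinity>"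
      by (simp add: suminf_ennreal2 ennreal_less_top)
    moreover have "?m < \<infinity>"
      by (rule emeasure_dv_compact[OF compact_cball_of_basis])
    ultimately show ?thesis
      by (simp add: ennreal_mult_less_top)
  qed
  finally show ?thesis .
qed

lemma integrable_gauss_weight:
  fixes g :: "'a \<Rightarrow> real"
  assumes g: "continuous_on UNIV g" and c: "c \<ge> 0" and bound: "\<And>v. \<bar>g v\<bar> \<le> C * exp (c * norm v)"
  shows "integrable dv (\<lambda>v. gauss_weight v * g v)"
proof -
  have "integrable dv (\<lambda>v. exp (c * norm v - (norm v)\<^sup>2 / 2))"
    using nn_integral_exp_norm_gaussian[OF c]
    by (intro integrableI_nonneg borel_measurable_continuous_dv continuous_intros) auto
  moreover have "gauss_weight v * exp (c * norm v) = exp (c * norm v - (norm v)\<^sup>2 / 2)" for v :: 'a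
    by (simp add: gauss_weight_def power2_norm_eq_inner flip: exp_add)
  ultimately have "integrable dv (\<lambda>v. gauss_weight v * exp (c * norm v))"
    by simp
  then have int: "integrable dv (\<lambda>v. C * (gauss_weight v * exp (c * norm v)))"
    by simp
  show ?thesis
  proof (rule Bochner_Integration.integrable_bound[OF int])
    show "(\<lambda>v. gauss_weight v * g v) \<in> borel_measurable dv"
      by (intro borel_measurable_continuous_dv continuous_intros continuous_gauss_weight g)
    show "AE v in dv. norm (gauss_weight v * g v) \<le> norm (C * (gauss_weight v * exp (c * norm v)))"
    proof (rule AE_I2)
      fix v
      have "gauss_weight v * \<bar>g v\<bar> \<le> gauss_weight v * (C * exp (c * norm v))"
        using gauss_weight_pos[of v] bound[of v] by (intro mult_left_mono) auto
      also have "\<dots> \<le> \<bar>C * (gauss_weight v * exp (c * norm v))\<bar>"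
        by (simp add: mult_ac)
      finally show "norm (gauss_weight v * g v) \<le> norm (C * (gauss_weight v * exp (c * norm v)))"
        using gauss_weight_pos[of v] by (simp add: abs_mult)
    qed
  qed
qed

text \<open>
  A nonnegative integral vanishes only if the integrand does almost everywhere, but the weight
  vanishes nowhere and \<open>dv \<noteq> 0\<close>.
\<close>

lemma integral_gauss_weight_pos: "(LINT v|dv. gauss_weight v) > 0"
proof -
  have int: "integrable dv (\<lambda>v. gauss_weight v)"
    using integrable_gauss_weight[of "\<lambda>_. 1" 0 1] by simp
  have "\<not> (AE v in dv. gauss_weight v = 0)"
  proof
    assume "AE v in dv. gauss_weight v = 0"
    then have "AE v in dv. False"
      using gauss_weight_pos by (auto elim!: eventually_mono simp: less_le)
    then show False
      using emeasure_dv_UNIV ae_filter_eq_bot_iff[of dv] by (simp add: eventually_False)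
  qed
  moreover have "(LINT v|dv. gauss_weight v) \<ge> 0"
    by (intro integral_nonneg_AE AE_I2) (simp add: gauss_weight_def)
  ultimately show ?thesis
    using integral_nonneg_eq_0_iff_AE[OF int] by (force simp: gauss_weight_def less_le)
qed

lemma integrable_gaussian_iff:
  fixes g :: "'a \<Rightarrow> real"
  assumes "continuous_on UNIV g"
  shows "integrable (gaussian dv) g \<longleftrightarrow> integrable dv (\<lambda>v. gauss_weight v * g v)"
    and "(LINT v|gaussian dv. g v) = (LINT v|dv. gauss_weight v * g v) / (LINT v|dv. gauss_weight v)"
proof -
  define A where "A = (LINT v|dv. gauss_weight v)"
  have A: "A > 0"
    using integral_gauss_weight_pos by (simp add: A_def)
  have eq: "gaussian dv = density dv (\<lambda>v. ennreal (1 / A * gauss_weight v))"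
    by (simp add: gaussian_def gauss_weight_def A_def)
  have meas: "g \<in> borel_measurable dv" "(\<lambda>v. 1 / A * gauss_weight v) \<in> borel_measurable dv"
    by (intro borel_measurable_continuous_dv continuous_intros continuous_gauss_weight assms)+
  have pos: "AE v in dv. 0 \<le> 1 / A * gauss_weight v"
    using A by (simp add: gauss_weight_def)
  have "integrable (gaussian dv) g \<longleftrightarrow> integrable dv (\<lambda>v. (1 / A) * (gauss_weight v * g v))"
    unfolding eq integrable_density[OF meas pos] by (simp add: mult_ac)
  also have "\<dots> \<longleftrightarrow> integrable dv (\<lambda>v. gauss_weight v * g v)"
    unfolding integrable_mult_left_iff using A by simp
  finally show "integrable (gaussian dv) g \<longleftrightarrow> integrable dv (\<lambda>v. gauss_weight v * g v)" .
  have "(LINT v|gaussian dv. g v) = (LINT v|dv. (1 / A) * (gauss_weight v * g v))"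
    unfolding eq integral_density[OF meas pos] by (simp add: mult_ac)
  then show "(LINT v|gaussian dv. g v) = (LINT v|dv. gauss_weight v * g v) / (LINT v|dv. gauss_weight v)"
    by (simp add: A_def)
qed

lemma integral_dv_translate:
  fixes g :: "'a \<Rightarrow> real"
  assumes "continuous_on UNIV g"
  shows "(LINT v|dv. g (v + a)) = (LINT v|dv. g v)"
proof -
  have "(LINT v|dv. g v) = (LINT v|distr dv borel (\<lambda>v. a + v). g v)"
    by (simp add: distr_dv)
  also have "\<dots> = (LINT v|dv. g (a + v))"
    by (intro integral_distr borel_measurable_continuous_dv borel_measurable_continuous_onI
        continuous_intros assms)
  finally show ?thesis
    by (simp add: add.commute)
qed

lemma integrable_linear_product:
  assumes "\<And>h. h \<in> H \<Longrightarrow> norm (a h) = 1"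
  shows "integrable (gaussian dv) (linear_product a H)"
  unfolding integrable_gaussian_iff(1)[OF continuous_linear_product]
proof (rule integrable_gauss_weight)
  fix v
  show "\<bar>linear_product a H v\<bar> \<le> 1 * exp (real (card H) * norm v)"
    using abs_linear_product_le[of H a v "norm v + 1"] assms power_norm_le_exp[of v "card H"] by auto
qed (auto intro: continuous_linear_product)

text \<open>
  Gaussian integration by parts. By translation invariance
  \<open>\<integral> \<phi> t v d\<mu>(v)\<close> does not depend on \<open>t\<close>, where
  \<open>\<phi> t v = exp (- t (v, u) - t\<^sup>2 / 2) \<Prod>\<^sub>h (v + t u, a\<^sub>h)\<close> arises from the monomial and the
  density by the translation \<open>v \<mapsto> v + t u\<close>. The claim is that its derivative at \<open>t = 0\<close>
  is zero. The derivative is taken under the integral by dominated convergence, the mean value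
  theorem bounding the difference quotients by a multiple of \<open>exp (c |v|)\<close>.
\<close>

lemma stein_identity:
  assumes H: "finite H" "\<And>h. h \<in> H \<Longrightarrow> norm (a h) = 1" and u: "norm u = 1"
  shows "(LINT v|gaussian dv. (v \<bullet> u) * linear_product a H v)
    = (\<Sum>h\<in>H. (u \<bullet> a h) * (LINT v|gaussian dv. linear_product a (H - {h}) v))"
proof -
  define n where "n = card H"
  define \<phi> where "\<phi> t v = exp (- t * (v \<bullet> u) - t\<^sup>2 / 2) * linear_product a H (v + t *\<^sub>R u)" for t v
  define \<phi>' where "\<phi>' t v = exp (- t * (v \<bullet> u) - t\<^sup>2 / 2) *
    ((\<Sum>h\<in>H. (u \<bullet> a h) * linear_product a (H - {h}) (v + t *\<^sub>R u))
      - (v \<bullet> u + t) * linear_product a H (v + t *\<^sub>R u))" for t v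
  have cont: "continuous_on UNIV (\<phi> t)" "continuous_on UNIV (\<phi>' t)" for t
    unfolding \<phi>_def \<phi>'_def linear_product_def by (intro continuous_intros)+
  have deriv: "((\<lambda>t. \<phi> t v) has_field_derivative \<phi>' t v) (at t)" for t v
  proof -
    have "((\<lambda>t. linear_product a H (v + t *\<^sub>R u)) has_field_derivative
        (\<Sum>h\<in>H. (u \<bullet> a h) * linear_product a (H - {h}) (v + t *\<^sub>R u))) (at t)"
      unfolding linear_product_def
      by (rule has_field_derivative_prod)
        (auto simp: inner_add_left intro!: derivative_eq_intros)
    then show ?thesis
      unfolding \<phi>_def \<phi>'_def
      by (auto intro!: derivative_eq_intros simp: algebra_simps)
  qed
  have bound: "\<bar>\<phi>' t v\<bar> \<le> real (n + 1) * exp (real (n + 3) * norm v)" if t: "\<bar>t\<bar> \<le> 1" for t v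
  proof -
    let ?r = "norm v + 1"
    have r: "norm (v + t *\<^sub>R u) \<le> ?r"
      using norm_triangle_ineq[of v "t *\<^sub>R u"] t u by simp
    have vu: "\<bar>v \<bullet> u\<bar> \<le> norm v"
      using Cauchy_Schwarz_ineq2[of v u] u by simp
    have "\<bar>(\<Sum>h\<in>H. (u \<bullet> a h) * linear_product a (H - {h}) (v + t *\<^sub>R u))\<bar> \<le> (\<Sum>h\<in>H. ?r ^ (n + 1))"
    proof (rule order_trans[OF sum_abs sum_mono])
      fix h assume h: "h \<in> H"
      have "\<bar>u \<bullet> a h\<bar> \<le> 1"
        using Cauchy_Schwarz_ineq2[of u "a h"] u H(2)[OF h] by simp
      moreover have "\<bar>linear_product a (H - {h}) (v + t *\<^sub>R u)\<bar> \<le> ?r ^ card (H - {h})"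
        using H(2) r by (intro abs_linear_product_le) auto
      moreover have "?r ^ card (H - {h}) \<le> ?r ^ (n + 1)"
        using h H(1) by (intro power_increasing) (auto simp: n_def)
      ultimately have "\<bar>u \<bullet> a h\<bar> * \<bar>linear_product a (H - {h}) (v + t *\<^sub>R u)\<bar> \<le> 1 * ?r ^ (n + 1)"
        by (intro mult_mono) auto
      then show "\<bar>(u \<bullet> a h) * linear_product a (H - {h}) (v + t *\<^sub>R u)\<bar> \<le> ?r ^ (n + 1)"
        by (simp add: abs_mult)
    qed
    moreover have "\<bar>(v \<bullet> u + t) * linear_product a H (v + t *\<^sub>R u)\<bar> \<le> ?r * ?r ^ n"
      unfolding abs_mult n_def using H(2) r vu t
      by (intro mult_mono abs_linear_product_le) auto
    ultimately have "\<bar>(\<Sum>h\<in>H. (u \<bullet> a h) * linear_product a (H - {h}) (v + t *\<^sub>R u))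
        - (v \<bullet> u + t) * linear_product a H (v + t *\<^sub>R u)\<bar> \<le> (\<Sum>h\<in>H. ?r ^ (n + 1)) + ?r * ?r ^ n"
      by (rule order_trans[OF abs_triangle_ineq4 add_mono])
    also have "\<dots> = real (n + 1) * ?r ^ (n + 1)"
      by (simp add: n_def algebra_simps)
    finally have 1: "\<bar>(\<Sum>h\<in>H. (u \<bullet> a h) * linear_product a (H - {h}) (v + t *\<^sub>R u))
        - (v \<bullet> u + t) * linear_product a H (v + t *\<^sub>R u)\<bar> \<le> real (n + 1) * ?r ^ (n + 1)" .
    have "- t * (v \<bullet> u) \<le> \<bar>t\<bar> * \<bar>v \<bullet> u\<bar>"
      by (metis abs_ge_self abs_minus_cancel abs_mult mult_minus_left)
    also have "\<dots> \<le> 1 * norm v"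
      using t vu by (intro mult_mono) auto
    finally have "- t * (v \<bullet> u) - t\<^sup>2 / 2 \<le> norm v"
      using zero_le_power2[of t] by linarith
    then have 2: "exp (- t * (v \<bullet> u) - t\<^sup>2 / 2) \<le> exp (norm v)"
      by simp
    have "\<bar>\<phi>' t v\<bar> \<le> exp (norm v) * (real (n + 1) * ?r ^ (n + 1))"
      unfolding \<phi>'_def abs_mult abs_exp_cancel by (intro mult_mono 1 2) auto
    also have "\<dots> \<le> exp (norm v) * (real (n + 1) * exp (real (n + 1) * norm v))"
      using power_norm_le_exp[of v "n + 1"] by (intro mult_left_mono) auto
    also have "\<dots> = real (n + 1) * exp (real (n + 2) * norm v)"
      by (simp add: exp_add[symmetric] algebra_simps)
    also have "\<dots> \<le> real (n + 1) * exp (real (n + 3) * norm v)"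
      by (intro mult_left_mono) (auto intro!: mult_right_mono)
    finally show ?thesis .
  qed
  have int0: "integrable dv (\<lambda>v. gauss_weight v * \<phi> 0 v)"
    using integrable_linear_product[of H a, unfolded integrable_gaussian_iff(1)[OF continuous_linear_product]] H(2)
    by (simp add: \<phi>_def)
  have shift: "gauss_weight (v + t *\<^sub>R u) * linear_product a H (v + t *\<^sub>R u) = gauss_weight v * \<phi> t v" for t v
  proof -
    have "u \<bullet> u = 1"
      using u by (simp add: norm_eq_1)
    then have "gauss_weight (v + t *\<^sub>R u) = gauss_weight v * exp (- t * (v \<bullet> u) - t\<^sup>2 / 2)"
      by (simp add: gauss_weight_def inner_add inner_commute[of u v] power2_eq_square field_simps flip: exp_add)
    then show ?thesis
      by (simp add: \<phi>_def)
  qed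
  have const: "(LINT v|dv. gauss_weight v * \<phi> t v) = (LINT v|dv. gauss_weight v * \<phi> 0 v)" for t
  proof -
    have "(LINT v|dv. gauss_weight v * \<phi> t v) = (LINT v|dv. gauss_weight v * linear_product a H v)"
      unfolding shift[symmetric]
      by (rule integral_dv_translate)
        (intro continuous_intros continuous_gauss_weight continuous_linear_product)
    then show ?thesis
      by (simp add: \<phi>_def)
  qed
  have quot_bound: "\<bar>(\<phi> t v - \<phi> 0 v) / t\<bar> \<le> real (n + 1) * exp (real (n + 3) * norm v)"
    if t: "0 < t" "t \<le> 1" for t v
  proof -
    obtain s where s: "0 < s" "s < t" "\<phi> t v - \<phi> 0 v = (t - 0) * \<phi>' s v"
      using MVT2[of 0 t "\<lambda>t. \<phi> t v" "\<lambda>t. \<phi>' t v"] t deriv by blast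
    then show ?thesis
      using t bound[of s v] by simp
  qed
  define t where "t i = inverse (real (Suc i))" for i
  have t: "0 < t i" "t i \<le> 1" for i
    by (auto simp: t_def field_simps)
  have "t \<longlonglongrightarrow> 0"
    unfolding t_def by (rule LIMSEQ_inverse_real_of_nat)
  then have t_at: "filterlim t (at 0) sequentially"
    using t(1) by (auto simp: filterlim_at less_imp_neq[THEN not_sym] intro!: always_eventually)
  have "(\<lambda>i. LINT v|dv. gauss_weight v * ((\<phi> (t i) v - \<phi> 0 v) / t i))
      \<longlonglongrightarrow> (LINT v|dv. gauss_weight v * \<phi>' 0 v)"
  proof (rule integral_dominated_convergence)
    show "integrable dv (\<lambda>v. gauss_weight v * (real (n + 1) * exp (real (n + 3) * norm v)))"
      by (rule integrable_gauss_weight[where C = "real (n + 1)" and c = "real (n + 3)"])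
        (auto intro!: continuous_intros)
    show "AE v in dv. (\<lambda>i. gauss_weight v * ((\<phi> (t i) v - \<phi> 0 v) / t i)) \<longlonglongrightarrow> gauss_weight v * \<phi>' 0 v"
    proof (intro AE_I2 tendsto_mult tendsto_const)
      fix v
      have "((\<lambda>t. (\<phi> t v - \<phi> 0 v) / (t - 0)) \<longlongrightarrow> \<phi>' 0 v) (at 0)"
        using deriv[of v 0] by (simp add: has_field_derivative_iff)
      then show "(\<lambda>i. (\<phi> (t i) v - \<phi> 0 v) / t i) \<longlonglongrightarrow> \<phi>' 0 v"
        using filterlim_compose[OF _ t_at] by fastforce
    qed
    show "AE v in dv. norm (gauss_weight v * ((\<phi> (t i) v - \<phi> 0 v) / t i))
        \<le> gauss_weight v * (real (n + 1) * exp (real (n + 3) * norm v))" for i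
    proof (rule AE_I2)
      fix v
      show "norm (gauss_weight v * ((\<phi> (t i) v - \<phi> 0 v) / t i))
        \<le> gauss_weight v * (real (n + 1) * exp (real (n + 3) * norm v))"
        using mult_left_mono[OF quot_bound[OF t, of i v] less_imp_le[OF gauss_weight_pos[of v]]]
          gauss_weight_pos[of v] by (simp add: abs_mult)
    qed
  qed (use t(1)[THEN less_imp_neq] in \<open>auto intro!: borel_measurable_continuous_dv continuous_intros continuous_gauss_weight cont\<close>)
  moreover have "(LINT v|dv. gauss_weight v * ((\<phi> (t i) v - \<phi> 0 v) / t i)) = 0" for i
  proof -
    have intt: "integrable dv (\<lambda>v. gauss_weight v * \<phi> (t i) v)"
    proof -
      have "integrable dv (\<lambda>v. t i * (gauss_weight v * ((\<phi> (t i) v - \<phi> 0 v) / t i)) + gauss_weight v * \<phi> 0 v)"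
        by (intro Bochner_Integration.integrable_add integrable_mult_right integrable_gauss_weight
            [where C = "real (n + 1)" and c = "real (n + 3)"] int0 quot_bound t)
          (use t(1)[THEN less_imp_neq] in \<open>auto intro!: continuous_intros cont\<close>)
      moreover have "t i * (gauss_weight v * ((\<phi> (t i) v - \<phi> 0 v) / t i)) + gauss_weight v * \<phi> 0 v
          = gauss_weight v * \<phi> (t i) v" for v
        using t(1)[of i] by (simp add: field_simps)
      ultimately show ?thesis
        by simp
    qed
    have "(LINT v|dv. gauss_weight v * ((\<phi> (t i) v - \<phi> 0 v) / t i))
        = (LINT v|dv. (gauss_weight v * \<phi> (t i) v - gauss_weight v * \<phi> 0 v) / t i)"
      by (simp add: right_diff_distrib)
    also have "\<dots> = 0"
      using intt int0 const[of "t i"] by simp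
    finally show ?thesis .
  qed
  ultimately have zero: "(LINT v|dv. gauss_weight v * \<phi>' 0 v) = 0"
    by (simp only: LIMSEQ_const_iff)
  let ?g = "\<lambda>v. (\<Sum>h\<in>H. (u \<bullet> a h) * linear_product a (H - {h}) v)"
  have "(LINT v|gaussian dv. \<phi>' 0 v) = 0"
    by (simp add: integrable_gaussian_iff(2)[OF cont(2)] zero)
  then have 0: "(LINT v|gaussian dv. ?g v - (v \<bullet> u) * linear_product a H v) = 0"
    by (simp add: \<phi>'_def)
  have intg: "integrable (gaussian dv) ?g"
    by (intro Bochner_Integration.integrable_sum integrable_mult_right integrable_linear_product H(2)) auto
  have eq: "\<phi>' 0 v = ?g v - (v \<bullet> u) * linear_product a H v" for v
    by (simp add: \<phi>'_def)
  have "integrable (gaussian dv) (\<phi>' 0)"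
    unfolding integrable_gaussian_iff(1)[OF cont(2)]
    by (rule integrable_gauss_weight[where C = "real (n + 1)" and c = "real (n + 3)"])
      (use bound[of 0] in \<open>auto intro: cont\<close>)
  with intg have "integrable (gaussian dv) (\<lambda>v. ?g v - \<phi>' 0 v)"
    by (rule Bochner_Integration.integrable_diff)
  then have "integrable (gaussian dv) (\<lambda>v. (v \<bullet> u) * linear_product a H v)"
    by (simp add: eq)
  then have "(LINT v|gaussian dv. (v \<bullet> u) * linear_product a H v) = (LINT v|gaussian dv. ?g v)"
    using 0 intg by simp
  also have "\<dots> = (\<Sum>h\<in>H. (u \<bullet> a h) * (LINT v|gaussian dv. linear_product a (H - {h}) v))"
    by (subst Bochner_Integration.integral_sum) (auto intro!: integrable_mult_right integrable_linear_product H(2))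
  finally show ?thesis .
qed

lemma integral_gaussian_one: "(LINT v|gaussian dv. 1 :: real) = 1"
  using integral_gauss_weight_pos by (subst integrable_gaussian_iff(2)) auto

text \<open>
  Stein's identity for \<open>u = e\<^bsub>c(h\<^sub>0)\<^esub>\<close> matches \<open>h\<^sub>0\<close> with each other \<open>h\<close> in turn, and
  orthonormality keeps the terms with \<open>c(h) = c(h\<^sub>0)\<close>.
\<close>

lemma wick_formula:
  assumes "finite H" "\<And>h. h \<in> H \<Longrightarrow> c h < d"
  shows "(LINT v|gaussian dv. linear_product (e \<circ> c) H v)
    = (\<Sum>\<sigma>\<in>pairings H. if \<forall>h\<in>H. c (\<sigma> h) = c h then 1 else 0)"
  using assms
proof (induction "card H" arbitrary: H rule: less_induct)
  case less
  show ?case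
  proof (cases "H = {}")
    case True
    then show ?thesis
      using integral_gaussian_one by (simp add: linear_product_def[abs_def])
  next
    case False
    then obtain h\<^sub>0 where h0: "h\<^sub>0 \<in> H"
      by blast
    let ?H = "H - {h\<^sub>0}"
    have "linear_product (e \<circ> c) H v = (v \<bullet> e (c h\<^sub>0)) * linear_product (e \<circ> c) ?H v" for v
      unfolding linear_product_def using prod.remove[OF less.prems(1) h0] by simp
    then have "(LINT v|gaussian dv. linear_product (e \<circ> c) H v)
        = (LINT v|gaussian dv. (v \<bullet> e (c h\<^sub>0)) * linear_product (e \<circ> c) ?H v)"
      by (rule Bochner_Integration.integral_cong[OF refl])
    also have "\<dots> = (\<Sum>h\<in>?H. (e (c h\<^sub>0) \<bullet> (e \<circ> c) h) * (LINT v|gaussian dv. linear_product (e \<circ> c) (?H - {h}) v))"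
      using less.prems h0 by (intro stein_identity) (auto simp: norm_basis)
    also have "\<dots> = (\<Sum>h\<in>?H. \<Sum>\<tau>\<in>pairings (?H - {h}).
        if \<forall>x\<in>H. c ((\<tau>(h\<^sub>0 := h, h := h\<^sub>0)) x) = c x then 1 else 0)"
    proof (rule sum.cong[OF refl])
      fix h assume h: "h \<in> ?H"
      have "card (?H - {h}) < card H"
        using h h0 less.prems(1) by (intro psubset_card_mono) auto
      then have "(LINT v|gaussian dv. linear_product (e \<circ> c) (?H - {h}) v)
          = (\<Sum>\<tau>\<in>pairings (?H - {h}). if \<forall>x\<in>?H - {h}. c (\<tau> x) = c x then 1 else 0)"
        using less.prems by (intro less.hyps) auto
      moreover have "e (c h\<^sub>0) \<bullet> (e \<circ> c) h = (if c h\<^sub>0 = c h then 1 else 0)"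
        using h h0 less.prems(2) by (simp add: inner_basis)
      moreover have "(\<forall>x\<in>H. c ((\<tau>(h\<^sub>0 := h, h := h\<^sub>0)) x) = c x)
          \<longleftrightarrow> c h\<^sub>0 = c h \<and> (\<forall>x\<in>?H - {h}. c (\<tau> x) = c x)" for \<tau>
        using h h0 by (auto 0 3)
      ultimately show "(e (c h\<^sub>0) \<bullet> (e \<circ> c) h) * (LINT v|gaussian dv. linear_product (e \<circ> c) (?H - {h}) v)
          = (\<Sum>\<tau>\<in>pairings (?H - {h}). if \<forall>x\<in>H. c ((\<tau>(h\<^sub>0 := h, h := h\<^sub>0)) x) = c x then 1 else 0)"
        by simp
    qed
    also have "\<dots> = (\<Sum>\<sigma>\<in>pairings H. if \<forall>h\<in>H. c (\<sigma> h) = c h then 1 else 0)"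
      by (rule sum_pairings_remove[OF less.prems(1) h0, symmetric])
    finally show ?thesis .
  qed
qed


end

end

section \<open>Set partitions with prescribed block sizes\<close>

text \<open>
  The monomial \<open>\<Prod>\<^bsub>B\<in>P\<^esub> x\<^bsub>|B|\<^esub>\<close>; for the vertices of a graph it records how many vertices
  there are of each valence.
\<close>

definition block_type :: "'h set set \<Rightarrow> (nat \<Rightarrow>\<^sub>0 nat)" where
  "block_type P = (\<Sum>B\<in>P. Poly_Mapping.single (card B) 1)"

lemma weighted_degree_sum: "weighted_degree w (\<Sum>i\<in>I. m i) = (\<Sum>i\<in>I. weighted_degree w (m i))"
  by (induction I rule: infinite_finite_induct) (simp_all add: weighted_degree_add)

lemma partition_on_finite:
  assumes "partition_on H P" "finite H"
  shows "finite P" "B \<in> P \<Longrightarrow> finite B"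
  using assms finite_UnionD[of P] finite_subset[of B H] by (auto simp: partition_on_def)

lemma weighted_degree_block_type:
  assumes "partition_on H P" "finite H"
  shows "weighted_degree id (block_type P) = card H"
proof -
  have "weighted_degree id (block_type P) = (\<Sum>B\<in>P. card B)"
    unfolding block_type_def weighted_degree_sum weighted_degree_single by simp
  also have "\<dots> = card (\<Union>P)"
    by (rule card_Union_disjoint[symmetric])
      (use assms partition_on_finite[OF assms] in \<open>auto simp: partition_on_def disjoint_def pairwise_def disjnt_def\<close>)
  finally show ?thesis
    using partition_onD1[OF assms(1)] by simp
qed

lemma card_subsets_containing:
  assumes "finite H" "h \<in> H"
  shows "card {B. h \<in> B \<and> B \<subseteq> H \<and> card B = Suc k} = (card H - 1) choose k"
proof -
  have "card {B. h \<in> B \<and> B \<subseteq> H \<and> card B = Suc k} = card {C. C \<subseteq> H - {h} \<and> card C = k}"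
  proof (rule bij_betw_same_card[OF bij_betw_byWitness[where f' = "insert h" and f = "\<lambda>B. B - {h}"]])
    show "insert h ` {C. C \<subseteq> H - {h} \<and> card C = k} \<subseteq> {B. h \<in> B \<and> B \<subseteq> H \<and> card B = Suc k}"
    proof safe
      fix C assume C: "C \<subseteq> H - {h}"
      then have "finite C"
        using assms(1) by (auto intro: finite_subset)
      then show "card (insert h C) = Suc (card C)"
        using C by (intro card_insert_disjoint) auto
    qed (use assms in auto)
    show "(\<lambda>B. B - {h}) ` {B. h \<in> B \<and> B \<subseteq> H \<and> card B = Suc k} \<subseteq> {C. C \<subseteq> H - {h} \<and> card C = k}"
      by auto
  qed auto
  also have "\<dots> = (card H - 1) choose k"
    using assms by (simp add: n_subsets)
  finally show ?thesis .
qed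

lemma fact_binomial_identity:
  fixes w :: "'c :: field_char_0"
  assumes "Suc k \<le> N"
  shows "of_nat ((N - 1) choose k) * (w * (fact (N - Suc k) * x))
    = fact (N - 1) * (of_nat (Suc k) * (w / fact (Suc k) * x))"
proof -
  obtain M where M: "N = Suc M" "k \<le> M"
    using assms by (cases N) auto
  then have "(fact (N - 1) :: 'c) = of_nat (fact k * fact (M - k) * (M choose k))"
    by (simp add: binomial_fact_lemma)
  then have *: "(fact (N - 1) :: 'c) = fact k * fact (N - Suc k) * of_nat ((N - 1) choose k)"
    by (simp add: M(1))
  have "(of_nat (Suc k) :: 'c) * (w / fact (Suc k) * x) = w / fact k * x"
    by (simp add: field_simps del: of_nat_Suc)
  then show ?thesis
    unfolding * by (simp add: field_simps del: of_nat_Suc)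
qed

text \<open>
  The exponential formula for set partitions. Choose \<open>h \<in> H\<close> and sum over its block \<open>B\<close>, for
  which there are \<open>(N - 1) choose (k - 1)\<close> choices of size \<open>k\<close>; the other blocks form a
  partition of \<open>H - B\<close>. After multiplication with the factorials this recursion is the Euler
  relation for \<open>exp_coeff\<close> with weight \<open>k\<close> on \<open>x\<^sub>k\<close>. The value \<open>a\<^sub>0 = 0\<close> reflects that blocks are
  nonempty.
\<close>

lemma sum_partitions_prod_card:
  fixes w a :: "nat \<Rightarrow> 'c :: field_char_0"
  assumes a: "a 0 = 0" "\<And>k. k \<ge> 1 \<Longrightarrow> a k = w k / fact k"
    and "finite H" "weighted_degree id n = card H"
  shows "(\<Sum>P | partition_on H P \<and> block_type P = n. \<Prod>B\<in>P. w (card B)) = fact (card H) * exp_coeff a n"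
  using assms(3-)
proof (induction "card H" arbitrary: H n rule: less_induct)
  case less
  note fin = less.prems(1) and deg = less.prems(2)
  show ?case
  proof (cases "H = {}")
    case True
    \<comment> \<open>The weight does not see the variable \<open>x\<^sub>0\<close>, so monomials \<open>x\<^sub>0 ^ j\<close> have to be treated separately.\<close>
    have keys: "Poly_Mapping.keys n \<subseteq> {0}"
      using deg True by (auto simp: weighted_degree_def in_keys_iff)
    show ?thesis
    proof (cases "n = 0")
      case n: True
      have "{P. partition_on H P \<and> block_type P = n} = {{}}"
        using True n by (auto simp: partition_on_empty block_type_def)
      then show ?thesis
        by (simp add: True n exp_coeff_def)
    next
      case n: False
      then have "Poly_Mapping.keys n \<noteq> {}"
        by simp
      with keys have "Poly_Mapping.keys n = {0}"
        by (metis subset_singletonD)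
      moreover from this have "Poly_Mapping.lookup n 0 \<noteq> 0"
        by (metis in_keys_iff singletonI)
      ultimately have "exp_coeff a n = 0"
        by (simp add: exp_coeff_def a(1))
      moreover have "{P. partition_on H P \<and> block_type P = n} = {}"
        using True n by (auto simp: partition_on_empty block_type_def)
      ultimately show ?thesis
        by (simp only: sum.empty mult_zero_right)
    qed
  next
    case False
    then obtain h where h: "h \<in> H"
      by blast
    let ?N = "card H"
    define \<B> where "\<B> = {B. h \<in> B \<and> B \<subseteq> H \<and> card B \<in> Poly_Mapping.keys n}"
    define \<P> where "\<P> B = {P. partition_on (H - B) P \<and> block_type P = n - Poly_Mapping.single (card B) 1}" for B
    have finB: "finite \<B>" "B \<in> \<B> \<Longrightarrow> finite B" for B
      using fin by (auto simp: \<B>_def intro: finite_subset[of _ H] rev_finite_subset[of "Pow H"])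
    have finP: "finite (\<P> B)" "P \<in> \<P> B \<Longrightarrow> finite P" for B P
      using fin finitely_many_partition_on[of "H - B"]
      by (auto simp: \<P>_def intro: finite_subset partition_on_finite)
    have notin: "h \<notin> B'" if "B \<in> \<B>" "P \<in> \<P> B" "B' \<in> P" for B P B'
      using that by (auto simp: \<B>_def \<P>_def partition_on_def)
    have notin': "B \<notin> P" if "B \<in> \<B>" "P \<in> \<P> B" for B P
      using notin[OF that] that(1) by (auto simp: \<B>_def)
    have inj: "inj_on (\<lambda>(B, P). insert B P) (Sigma \<B> \<P>)"
    proof (rule inj_onI, clarify)
      fix B P B' P'
      assume *: "B \<in> \<B>" "P \<in> \<P> B" "B' \<in> \<B>" "P' \<in> \<P> B'" "insert B P = insert B' P'"
      have "h \<in> B" "h \<in> B'"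
        using * by (auto simp: \<B>_def)
      then have "B = B'"
        using notin[OF *(1,2)] *(5) by blast
      then show "B = B' \<and> P = P'"
        using notin'[OF *(1,2)] notin'[OF *(3,4)] *(5) by (metis insert_ident)
    qed
    have image: "(\<lambda>(B, P). insert B P) ` Sigma \<B> \<P> = {P. partition_on H P \<and> block_type P = n}"
    proof (intro equalityI subsetI)
      fix Q assume "Q \<in> (\<lambda>(B, P). insert B P) ` Sigma \<B> \<P>"
      then obtain B P where Q: "Q = insert B P" "B \<in> \<B>" "P \<in> \<P> B"
        by auto
      have "disjnt B (\<Union>P)"
        using Q(3) by (auto simp: \<P>_def partition_on_def disjnt_def)
      then have "partition_on H Q"
        using Q by (auto simp: \<P>_def \<B>_def partition_on_insert)
      moreover have "block_type Q = Poly_Mapping.single (card B) 1 + block_type P"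
        using Q notin'[OF Q(2,3)] finP(2)[OF Q(3)] by (simp add: block_type_def)
      ultimately show "Q \<in> {P. partition_on H P \<and> block_type P = n}"
        using Q(2,3) keys_eq_single_add[of "card B" n] by (simp add: \<P>_def \<B>_def)
    next
      fix Q assume "Q \<in> {P. partition_on H P \<and> block_type P = n}"
      then have Q: "partition_on H Q" "block_type Q = n"
        by auto
      obtain B where B: "B \<in> Q" "h \<in> B"
        using Q(1) h by (auto simp: partition_on_def)
      have disj: "disjnt B (\<Union>(Q - {B}))"
        using Q(1) B by (auto simp: partition_on_def disjoint_def disjnt_def)
      have ins: "insert B (Q - {B}) = Q"
        using B by auto
      have part: "partition_on (H - B) (Q - {B})" "B \<subseteq> H"
        using partition_on_insert[OF disj, of H, unfolded ins] Q(1) by simp_all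
      have n: "n = Poly_Mapping.single (card B) 1 + block_type (Q - {B})"
        unfolding Q(2)[symmetric] block_type_def
        by (rule sum.remove) (use partition_on_finite[OF Q(1) fin] B in auto)
      have "card B \<in> Poly_Mapping.keys n"
        by (simp add: n in_keys_iff lookup_add)
      moreover have "block_type (Q - {B}) = n - Poly_Mapping.single (card B) 1"
        by (simp add: n)
      ultimately have "(B, Q - {B}) \<in> Sigma \<B> \<P>"
        using part B by (auto simp: \<B>_def \<P>_def)
      from imageI[OF this, of "\<lambda>(B, P). insert B P"]
      show "Q \<in> (\<lambda>(B, P). insert B P) ` Sigma \<B> \<P>"
        by (simp only: ins prod.case)
    qed
    have le: "k \<le> ?N" if "k \<in> Poly_Mapping.keys n" for k
    proof -
      have "k \<le> id k * Poly_Mapping.lookup n k"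
        using that by (simp add: in_keys_iff)
      also have "\<dots> \<le> weighted_degree id n"
        unfolding weighted_degree_def by (rule member_le_sum[OF that]) auto
      finally show ?thesis
        by (simp add: deg)
    qed
    have IH: "(\<Sum>P\<in>\<P> B. \<Prod>B'\<in>P. w (card B'))
        = fact (?N - card B) * exp_coeff a (n - Poly_Mapping.single (card B) 1)" if B: "B \<in> \<B>" for B
    proof -
      have card: "card (H - B) = ?N - card B"
        using B finB(2)[OF B] by (intro card_Diff_subset) (auto simp: \<B>_def)
      have "card (H - B) < ?N"
        using B h fin by (intro psubset_card_mono) (auto simp: \<B>_def)
      moreover have "weighted_degree id (n - Poly_Mapping.single (card B) 1) = card (H - B)"
      proof -
        have "card B \<in> Poly_Mapping.keys n"
          using B by (simp add: \<B>_def)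
        then have "?N = weighted_degree id (Poly_Mapping.single (card B) 1 + (n - Poly_Mapping.single (card B) 1))"
          by (simp only: keys_eq_single_add deg)
        also have "\<dots> = card B + weighted_degree id (n - Poly_Mapping.single (card B) 1)"
          by (simp only: weighted_degree_add weighted_degree_single id_apply)
        finally show ?thesis
          by (simp add: card)
      qed
      ultimately show ?thesis
        unfolding \<P>_def card[symmetric] using fin by (intro less.hyps) auto
    qed
    have "(\<Sum>P | partition_on H P \<and> block_type P = n. \<Prod>B\<in>P. w (card B))
        = (\<Sum>(B, P)\<in>Sigma \<B> \<P>. \<Prod>B\<in>insert B P. w (card B))"
      unfolding image[symmetric] by (subst sum.reindex[OF inj]) (simp add: case_prod_unfold)
    also have "\<dots> = (\<Sum>B\<in>\<B>. \<Sum>P\<in>\<P> B. \<Prod>B\<in>insert B P. w (card B))"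
      by (rule sum.Sigma[symmetric]) (use finB finP in auto)
    also have "\<dots> = (\<Sum>B\<in>\<B>. w (card B) * (\<Sum>P\<in>\<P> B. \<Prod>B\<in>P. w (card B)))"
      using notin' finP by (intro sum.cong refl) (simp add: sum_distrib_left)
    also have "\<dots> = (\<Sum>B\<in>\<B>. w (card B) * (fact (?N - card B) * exp_coeff a (n - Poly_Mapping.single (card B) 1)))"
      by (intro sum.cong refl) (simp add: IH)
    also have "\<dots> = (\<Sum>k\<in>Poly_Mapping.keys n. \<Sum>B | B \<in> \<B> \<and> card B = k.
        w (card B) * (fact (?N - card B) * exp_coeff a (n - Poly_Mapping.single (card B) 1)))"
    proof (rule sum.group[symmetric])
      show "card ` \<B> \<subseteq> Poly_Mapping.keys n"
        by (auto simp: \<B>_def)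
    qed (simp_all add: finB(1))
    also have "\<dots> = (\<Sum>k\<in>Poly_Mapping.keys n.
        fact (?N - 1) * (of_nat (id k) * (a k * exp_coeff a (n - Poly_Mapping.single k 1))))"
    proof (rule sum.cong[OF refl])
      fix k assume k: "k \<in> Poly_Mapping.keys n"
      show "(\<Sum>B | B \<in> \<B> \<and> card B = k.
          w (card B) * (fact (?N - card B) * exp_coeff a (n - Poly_Mapping.single (card B) 1)))
        = fact (?N - 1) * (of_nat (id k) * (a k * exp_coeff a (n - Poly_Mapping.single k 1)))"
      proof (cases k)
        case 0
        have empty: "{B. B \<in> \<B> \<and> card B = k} = {}"
          using finite_subset[OF _ fin] 0 by (auto simp: \<B>_def card_gt_0_iff)
        show ?thesis
          unfolding empty by (simp add: 0)
      next
        case (Suc j)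
        have "{B. B \<in> \<B> \<and> card B = k} = {B. h \<in> B \<and> B \<subseteq> H \<and> card B = Suc j}"
          using k Suc by (auto simp: \<B>_def)
        then have card: "card {B. B \<in> \<B> \<and> card B = k} = (?N - 1) choose j"
          using card_subsets_containing[OF fin h] by simp
        have "(\<Sum>B | B \<in> \<B> \<and> card B = k.
            w (card B) * (fact (?N - card B) * exp_coeff a (n - Poly_Mapping.single (card B) 1)))
          = of_nat ((?N - 1) choose j) * (w k * (fact (?N - k) * exp_coeff a (n - Poly_Mapping.single k 1)))"
          by (simp add: card)
        also have "\<dots> = fact (?N - 1) * (of_nat (id k) * (a k * exp_coeff a (n - Poly_Mapping.single k 1)))"
          using fact_binomial_identity[of j ?N "w k"] le[OF k] a(2)[of k] by (simp add: Suc)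
        finally show ?thesis .
      qed
    qed
    also have "\<dots> = fact (?N - 1) * (of_nat ?N * exp_coeff a n)"
      unfolding sum_distrib_left[symmetric] sum_exp_coeff_diff_single deg ..
    also have "\<dots> = fact ?N * exp_coeff a n"
      using False fin by (cases ?N) (auto simp: algebra_simps)
    finally show ?thesis .
  qed
qed

section \<open>Expansion of symmetric tensors in an orthonormal basis\<close>

lemma of_V_expansion:
  assumes "orthonormal_basis d e"
  shows "of_V v = (\<Sum>i<d. cscale (complex_of_real (v \<bullet> e i)) (of_V (e i)))"
proof -
  have "(\<Sum>i<d. cscale (complex_of_real (v \<bullet> e i)) (of_V (e i))) = of_V (\<Sum>i<d. (v \<bullet> e i) *\<^sub>R e i)"
    unfolding of_V_def cscale_def by (simp add: prod_eq_iff fst_sum snd_sum)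
  then show ?thesis
    by (simp add: basis_expansion[OF assms])
qed

text \<open>
  Expand the entries \<open>v\<close> one at a time. The entries are labelled by a list \<open>hs\<close> of half-edges, and
  \<open>Xs\<close> collects the entries already replaced by basis vectors, which the induction moves past.
\<close>

lemma tensor_expansion:
  assumes basis: "orthonormal_basis d e" and lin: "tensor_linear k S"
    and "length Xs + length hs = k" "distinct hs"
  shows "S (Xs @ replicate (length hs) (of_V v))
    = (\<Sum>c\<in>set hs \<rightarrow>\<^sub>E {..<d}. complex_of_real (\<Prod>h\<in>set hs. v \<bullet> e (c h)) * S (Xs @ map (\<lambda>h. of_V (e (c h))) hs))"
  using assms(3,4)
proof (induction hs arbitrary: Xs)
  case Nil
  then show ?case
    by simp
next
  case (Cons h hs)
  let ?D = "{..<d}"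
  let ?L = "replicate (length hs) (of_V v)"
  let ?f = "\<lambda>X. S (Xs @ X # ?L)"
  have "length Xs + 1 + length ?L = k"
    using Cons.prems by simp
  then have "Vector_Spaces.linear cscale (*) ?f"
    using lin unfolding tensor_linear_def by blast
  then interpret f: Vector_Spaces.linear cscale "(*)" ?f .
  have "S (Xs @ replicate (length (h # hs)) (of_V v)) = ?f (\<Sum>i<d. cscale (complex_of_real (v \<bullet> e i)) (of_V (e i)))"
    by (simp flip: of_V_expansion[OF basis])
  also have "\<dots> = (\<Sum>i<d. complex_of_real (v \<bullet> e i) * S ((Xs @ [of_V (e i)]) @ ?L))"
    by (simp add: f.sum f.scale)
  also have "\<dots> = (\<Sum>i<d. complex_of_real (v \<bullet> e i) *
      (\<Sum>c\<in>set hs \<rightarrow>\<^sub>E ?D. complex_of_real (\<Prod>h\<in>set hs. v \<bullet> e (c h))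
        * S ((Xs @ [of_V (e i)]) @ map (\<lambda>h. of_V (e (c h))) hs)))"
    using Cons.prems by (subst Cons.IH) auto
  also have "\<dots> = (\<Sum>(i, c)\<in>?D \<times> (set hs \<rightarrow>\<^sub>E ?D). complex_of_real (v \<bullet> e i) *
      (complex_of_real (\<Prod>h\<in>set hs. v \<bullet> e (c h))
        * S ((Xs @ [of_V (e i)]) @ map (\<lambda>h. of_V (e (c h))) hs)))"
    by (simp add: sum_distrib_left sum.cartesian_product)
  also have "\<dots> = (\<Sum>(i, c)\<in>?D \<times> (set hs \<rightarrow>\<^sub>E ?D). complex_of_real (\<Prod>h'\<in>set (h # hs). v \<bullet> e ((c(h := i)) h'))
        * S (Xs @ map (\<lambda>h'. of_V (e ((c(h := i)) h'))) (h # hs)))"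
  proof (intro sum.cong refl, clarify)
    fix i c
    have "(\<Prod>h'\<in>set (h # hs). v \<bullet> e ((c(h := i)) h')) = (v \<bullet> e i) * (\<Prod>h\<in>set hs. v \<bullet> e (c h))"
      using Cons.prems by (simp, intro disjI2 prod.cong) auto
    moreover have "map (\<lambda>h'. of_V (e ((c(h := i)) h'))) hs = map (\<lambda>h. of_V (e (c h))) hs"
      using Cons.prems by auto
    ultimately show "complex_of_real (v \<bullet> e i) * (complex_of_real (\<Prod>h\<in>set hs. v \<bullet> e (c h))
        * S ((Xs @ [of_V (e i)]) @ map (\<lambda>h. of_V (e (c h))) hs))
      = complex_of_real (\<Prod>h'\<in>set (h # hs). v \<bullet> e ((c(h := i)) h'))
        * S (Xs @ map (\<lambda>h'. of_V (e ((c(h := i)) h'))) (h # hs))"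
      by (simp only: list.map fun_upd_same append_assoc append.simps of_real_mult mult.assoc)
  qed
  also have "\<dots> = (\<Sum>c\<in>set (h # hs) \<rightarrow>\<^sub>E ?D. complex_of_real (\<Prod>h'\<in>set (h # hs). v \<bullet> e (c h'))
        * S (Xs @ map (\<lambda>h'. of_V (e (c h'))) (h # hs)))"
    using Cons.prems
    by (simp only: list.set PiE_insert_eq) (subst sum.reindex[OF inj_combinator], simp_all add: case_prod_unfold)
  finally show ?case .
qed

text \<open>
  Maps on a disjoint union correspond to families of maps on the blocks.
\<close>

lemma sum_PiE_partition:
  assumes P: "partition_on H P"
    and F: "\<And>B c c'. B \<in> P \<Longrightarrow> (\<And>h. h \<in> B \<Longrightarrow> c h = c' h) \<Longrightarrow> F B c = F B c'"
  shows "(\<Sum>g\<in>(\<Pi>\<^sub>E B\<in>P. B \<rightarrow>\<^sub>E D). \<Prod>B\<in>P. F B (g B)) = (\<Sum>c\<in>H \<rightarrow>\<^sub>E D. \<Prod>B\<in>P. F B c)"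
proof -
  define b where "b h = (THE B. B \<in> P \<and> h \<in> B)" for h
  have b: "b h = B" if "B \<in> P" "h \<in> B" for B h
    unfolding b_def using P that by (intro the_equality) (auto simp: partition_on_def disjoint_def)
  have bP: "b h \<in> P" "h \<in> b h" if "h \<in> H" for h
    using that P b by (auto simp: partition_on_def)
  have sub: "h \<in> H" if "B \<in> P" "h \<in> B" for B h
    using P that by (auto simp: partition_on_def)
  show ?thesis
  proof (rule sum.reindex_bij_witness[where i = "\<lambda>c. \<lambda>B\<in>P. restrict c B" and j = "\<lambda>g. \<lambda>h\<in>H. g (b h) h"])
    fix g assume g: "g \<in> (\<Pi>\<^sub>E B\<in>P. B \<rightarrow>\<^sub>E D)"
    show "(\<lambda>B\<in>P. restrict (\<lambda>h\<in>H. g (b h) h) B) = g"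
    proof (rule PiE_ext[OF _ g])
      show "(\<lambda>B\<in>P. restrict (\<lambda>h\<in>H. g (b h) h) B) \<in> (\<Pi>\<^sub>E B\<in>P. B \<rightarrow>\<^sub>E D)"
        using g b sub by (auto 4 3 simp: PiE_iff)
      fix B assume B: "B \<in> P"
      have "restrict (\<lambda>h\<in>H. g (b h) h) B h = g B h" for h
        using g B b[OF B] sub[OF B] by (cases "h \<in> B") (auto simp: PiE_iff extensional_def)
      then show "(\<lambda>B\<in>P. restrict (\<lambda>h\<in>H. g (b h) h) B) B = g B"
        using B by auto
    qed
    show "(\<lambda>h\<in>H. g (b h) h) \<in> H \<rightarrow>\<^sub>E D"
      using g bP by (fastforce simp: PiE_iff)
    show "(\<Prod>B\<in>P. F B (\<lambda>h\<in>H. g (b h) h)) = (\<Prod>B\<in>P. F B (g B))"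
      using b sub by (intro prod.cong refl F) auto
  next
    fix c assume c: "c \<in> H \<rightarrow>\<^sub>E D"
    show "(\<lambda>h\<in>H. (\<lambda>B\<in>P. restrict c B) (b h) h) = c"
      using c bP by (auto simp: fun_eq_iff restrict_def PiE_iff extensional_def)
    show "(\<lambda>B\<in>P. restrict c B) \<in> (\<Pi>\<^sub>E B\<in>P. B \<rightarrow>\<^sub>E D)"
      using c sub by (auto simp: PiE_iff)
  qed
qed

lemma prod_tensor_expansion:
  fixes S :: "nat \<Rightarrow> 'a :: real_inner complexification list \<Rightarrow> complex" and H :: "'h :: linorder set"
  assumes basis: "orthonormal_basis d e" and lin: "\<And>k. k \<ge> 1 \<Longrightarrow> tensor_linear k (S k)"
    and P: "partition_on H P" and fin: "finite H"
  shows "(\<Prod>B\<in>P. S (card B) (replicate (card B) (of_V v)))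
    = (\<Sum>c\<in>H \<rightarrow>\<^sub>E {..<d}. complex_of_real (\<Prod>h\<in>H. v \<bullet> e (c h)) *
        (\<Prod>B\<in>P. S (card B) (map (\<lambda>h. of_V (e (c h))) (sorted_list_of_set B))))"
proof -
  note finP = partition_on_finite[OF P fin]
  let ?F = "\<lambda>B c. complex_of_real (\<Prod>h\<in>B. v \<bullet> e (c h)) *
    S (card B) (map (\<lambda>h. of_V (e (c h))) (sorted_list_of_set B))"
  have "S (card B) (replicate (card B) (of_V v)) = (\<Sum>c\<in>B \<rightarrow>\<^sub>E {..<d}. ?F B c)" if B: "B \<in> P" for B
  proof -
    have "finite B" "B \<noteq> {}"
      using B finP(2) P by (auto simp: partition_on_def)
    then have "tensor_linear (card B) (S (card B))"
      by (intro lin) (simp add: Suc_le_eq card_gt_0_iff)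
    from tensor_expansion[OF basis this, of "[]" "sorted_list_of_set B" v] show ?thesis
      using \<open>finite B\<close> by simp
  qed
  then have "(\<Prod>B\<in>P. S (card B) (replicate (card B) (of_V v))) = (\<Prod>B\<in>P. \<Sum>c\<in>B \<rightarrow>\<^sub>E {..<d}. ?F B c)"
    by (intro prod.cong) auto
  also have "\<dots> = (\<Sum>g\<in>(\<Pi>\<^sub>E B\<in>P. B \<rightarrow>\<^sub>E {..<d}). \<Prod>B\<in>P. ?F B (g B))"
    using finP by (intro prod_sum_PiE finite_PiE) auto
  also have "\<dots> = (\<Sum>c\<in>H \<rightarrow>\<^sub>E {..<d}. \<Prod>B\<in>P. ?F B c)"
  proof (rule sum_PiE_partition[OF P])
    fix B and c c' :: "'h \<Rightarrow> nat" assume "B \<in> P" and eq: "\<And>h. h \<in> B \<Longrightarrow> c h = c' h"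
    then have "map (\<lambda>h. of_V (e (c h))) (sorted_list_of_set B) = map (\<lambda>h. of_V (e (c' h))) (sorted_list_of_set B)"
      using finP(2) by auto
    moreover have "(\<Prod>h\<in>B. v \<bullet> e (c h)) = (\<Prod>h\<in>B. v \<bullet> e (c' h))"
      by (intro prod.cong) (auto simp: eq)
    ultimately show "?F B c = ?F B c'"
      by (simp only:)
  qed
  also have "\<dots> = (\<Sum>c\<in>H \<rightarrow>\<^sub>E {..<d}. complex_of_real (\<Prod>h\<in>H. v \<bullet> e (c h)) *
        (\<Prod>B\<in>P. S (card B) (map (\<lambda>h. of_V (e (c h))) (sorted_list_of_set B))))"
  proof (intro sum.cong refl)
    fix c
    have "(\<Prod>B\<in>P. \<Prod>h\<in>B. v \<bullet> e (c h)) = (\<Prod>h\<in>\<Union>P. v \<bullet> e (c h))"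
      using prod.Union_disjoint[of P "\<lambda>h. v \<bullet> e (c h)"] finP P
      by (auto simp: partition_on_def disjoint_def)
    then show "(\<Prod>B\<in>P. ?F B c) = complex_of_real (\<Prod>h\<in>H. v \<bullet> e (c h)) *
        (\<Prod>B\<in>P. S (card B) (map (\<lambda>h. of_V (e (c h))) (sorted_list_of_set B)))"
      unfolding prod.distrib using partition_onD1[OF P] by (simp flip: of_real_prod)
  qed
  finally show ?thesis .
qed

section \<open>Graph values and isomorphisms\<close>

text \<open>
  Colourings of the edges, seen on half-edges: both halves of an edge carry the colour of the
  edge. The set \<open>edges \<Gamma>\<close> changes with the involution, whereas colourings of half-edges for
  different involutions are subsets of one function space and can be summed in either order.
\<close>

definition colourings :: "nat \<Rightarrow> 'h graph \<Rightarrow> ('h \<Rightarrow> nat) set" where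
  "colourings d \<Gamma> = {c \<in> half_edges \<Gamma> \<rightarrow>\<^sub>E {..<d}. \<forall>h\<in>half_edges \<Gamma>. c (flip \<Gamma> h) = c h}"

lemma is_graphD:
  assumes "is_graph \<Gamma>"
  shows "finite (half_edges \<Gamma>)" "partition_on (half_edges \<Gamma>) (vertices \<Gamma>)"
    "h \<in> half_edges \<Gamma> \<Longrightarrow> flip \<Gamma> h \<in> half_edges \<Gamma>"
    "h \<in> half_edges \<Gamma> \<Longrightarrow> flip \<Gamma> (flip \<Gamma> h) = h"
    "h \<in> half_edges \<Gamma> \<Longrightarrow> flip \<Gamma> h \<noteq> h"
    "finite (vertices \<Gamma>)" "v \<in> vertices \<Gamma> \<Longrightarrow> v \<subseteq> half_edges \<Gamma>" 
    "v \<in> vertices \<Gamma> \<Longrightarrow> finite v" "v \<in> vertices \<Gamma> \<Longrightarrow> v \<noteq> {}"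
  using assms partition_on_finite[of "half_edges \<Gamma>" "vertices \<Gamma>"]
  by (auto simp: is_graph_def partition_on_def)

lemma graph_value_eq_sum_colourings:
  assumes g: "is_graph \<Gamma>"
  shows "graph_value d e A \<Gamma> = (\<Sum>c\<in>colourings d \<Gamma>. \<Prod>v\<in>vertices \<Gamma>.
    A (card v) (map (\<lambda>h. e (c h)) (sorted_list_of_set v)))"
proof -
  let ?H = "half_edges \<Gamma>"
  note g' = is_graphD[OF g]
  define p where "p \<epsilon> = (SOME h. h \<in> ?H \<and> \<epsilon> = {h, flip \<Gamma> h})" for \<epsilon>
  have p: "p \<epsilon> \<in> ?H" "\<epsilon> = {p \<epsilon>, flip \<Gamma> (p \<epsilon>)}" if "\<epsilon> \<in> edges \<Gamma>" for \<epsilon>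
    unfolding p_def using that someI_ex[of "\<lambda>h. h \<in> ?H \<and> \<epsilon> = {h, flip \<Gamma> h}"]
    by (auto simp: edges_def)
  have edge: "{h, flip \<Gamma> h} \<in> edges \<Gamma>" if "h \<in> ?H" for h
    using that by (auto simp: edges_def)
  have edge_flip: "{flip \<Gamma> h, flip \<Gamma> (flip \<Gamma> h)} = {h, flip \<Gamma> h}" if "h \<in> ?H" for h
    using g'(4)[OF that] by auto
  show ?thesis
    unfolding graph_value_def
  proof (rule sum.reindex_bij_witness[where
        i = "\<lambda>c. \<lambda>\<epsilon>\<in>edges \<Gamma>. c (p \<epsilon>)" and j = "\<lambda>c. \<lambda>h\<in>?H. c {h, flip \<Gamma> h}"])
    fix c assume c: "c \<in> edges \<Gamma> \<rightarrow>\<^sub>E {..<d}"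
    show "(\<lambda>\<epsilon>\<in>edges \<Gamma>. (\<lambda>h\<in>?H. c {h, flip \<Gamma> h}) (p \<epsilon>)) = c"
    proof
      fix \<epsilon>
      show "(\<lambda>\<epsilon>\<in>edges \<Gamma>. (\<lambda>h\<in>?H. c {h, flip \<Gamma> h}) (p \<epsilon>)) \<epsilon> = c \<epsilon>"
        using c p[of \<epsilon>] by (cases "\<epsilon> \<in> edges \<Gamma>") (auto simp: PiE_iff extensional_def)
    qed
    show "(\<lambda>h\<in>?H. c {h, flip \<Gamma> h}) \<in> colourings d \<Gamma>"
      using c edge edge_flip g'(3) by (auto simp: colourings_def PiE_iff)
    show "(\<Prod>v\<in>vertices \<Gamma>. A (card v) (map (\<lambda>h. e ((\<lambda>h\<in>?H. c {h, flip \<Gamma> h}) h)) (sorted_list_of_set v)))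
        = (\<Prod>v\<in>vertices \<Gamma>. A (card v) (map (\<lambda>h. e (c {h, flip \<Gamma> h})) (sorted_list_of_set v)))"
      using g'(7,8) by (intro prod.cong refl arg_cong2[where f = A] map_cong) (auto simp: subset_iff)
  next
    fix c assume c: "c \<in> colourings d \<Gamma>"
    have pc: "c (p {h, flip \<Gamma> h}) = c h" if h: "h \<in> ?H" for h
    proof -
      have "p {h, flip \<Gamma> h} = h \<or> p {h, flip \<Gamma> h} = flip \<Gamma> h"
        using p(2)[OF edge[OF h]] by (auto simp: doubleton_eq_iff)
      then show ?thesis
        using c h by (auto simp: colourings_def)
    qed
    show "(\<lambda>h\<in>?H. (\<lambda>\<epsilon>\<in>edges \<Gamma>. c (p \<epsilon>)) {h, flip \<Gamma> h}) = c"
      using c pc edge by (auto simp: fun_eq_iff colourings_def PiE_iff extensional_def)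
    show "(\<lambda>\<epsilon>\<in>edges \<Gamma>. c (p \<epsilon>)) \<in> edges \<Gamma> \<rightarrow>\<^sub>E {..<d}"
      using c p(1) by (auto simp: colourings_def PiE_iff)
  qed
qed

lemma tensor_symmetric_mset:
  assumes "tensor_symmetric k S" "mset Xs = mset Ys" "length Ys = k"
  shows "S Xs = S Ys"
proof -
  obtain \<sigma> where "\<sigma> permutes {..<length Ys}" "permute_list \<sigma> Ys = Xs"
    using mset_eq_permutation[OF assms(2)] by blast
  then show ?thesis
    using assms(1,3) unfolding tensor_symmetric_def by blast
qed

lemma graph_iso_inj_vertices:
  assumes "is_graph \<Gamma>" "graph_iso \<phi> \<Gamma> \<Gamma>'"
  shows "inj_on ((`) \<phi>) (vertices \<Gamma>)"
proof (rule inj_on_subset[OF inj_on_image_Pow])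
  show "inj_on \<phi> (half_edges \<Gamma>)"
    using assms(2) by (auto simp: graph_iso_def bij_betw_def)
qed (use is_graphD(7)[OF assms(1)] in auto)

lemma graph_iso_card_vertex:
  assumes "is_graph \<Gamma>" "graph_iso \<phi> \<Gamma> \<Gamma>'" "v \<in> vertices \<Gamma>"
  shows "card (\<phi> ` v) = card v"
  using assms is_graphD(7)[OF assms(1,3)]
  by (intro card_image) (auto simp: graph_iso_def bij_betw_def intro: inj_on_subset)

lemma block_type_iso:
  assumes "is_graph \<Gamma>" "graph_iso \<phi> \<Gamma> \<Gamma>'"
  shows "block_type (vertices \<Gamma>') = block_type (vertices \<Gamma>)"
proof -
  have "vertices \<Gamma>' = (`) \<phi> ` vertices \<Gamma>"
    using assms(2) by (simp add: graph_iso_def)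
  then show ?thesis
    unfolding block_type_def using graph_iso_inj_vertices[OF assms] graph_iso_card_vertex[OF assms]
    by (simp add: sum.reindex)
qed

text \<open>
  An isomorphism transports colourings. The half-edges at a vertex may be listed in a different
  order afterwards, which symmetric tensors do not notice.
\<close>

lemma graph_value_iso:
  fixes S :: "nat \<Rightarrow> 'v list \<Rightarrow> complex" and \<Gamma> :: "'h :: linorder graph" and \<Gamma>' :: "'k :: linorder graph"
  assumes g: "is_graph \<Gamma>" and g': "is_graph \<Gamma>'" and iso: "graph_iso \<phi> \<Gamma> \<Gamma>'"
    and sym: "\<And>k. k \<ge> 1 \<Longrightarrow> tensor_symmetric k (S k)"
  shows "graph_value d e S \<Gamma>' = graph_value d e S \<Gamma>"
proof -
  let ?H = "half_edges \<Gamma>" and ?H' = "half_edges \<Gamma>'"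
  have bij: "bij_betw \<phi> ?H ?H'" and V: "vertices \<Gamma>' = (`) \<phi> ` vertices \<Gamma>"
    and flp: "\<And>h. h \<in> ?H \<Longrightarrow> flip \<Gamma>' (\<phi> h) = \<phi> (flip \<Gamma> h)"
    using iso by (auto simp: graph_iso_def)
  have \<phi>: "\<phi> h \<in> ?H'" if "h \<in> ?H" for h
    using bij that by (auto simp: bij_betw_def)
  let ?\<psi> = "inv_into ?H \<phi>"
  have \<psi>: "?\<psi> h \<in> ?H" "\<phi> (?\<psi> h) = h" if "h \<in> ?H'" for h
    using bij that by (auto simp: bij_betw_def inv_into_into f_inv_into_f)
  have \<psi>\<phi>: "?\<psi> (\<phi> h) = h" if "h \<in> ?H" for h
    using bij that by (auto simp: bij_betw_def)
  let ?t = "\<lambda>c v. S (card v) (map (\<lambda>h. e (c h)) (sorted_list_of_set v))"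
  have vertex: "?t c' (\<phi> ` v) = ?t (\<lambda>h\<in>?H. c' (\<phi> h)) v" if v: "v \<in> vertices \<Gamma>" for c' v
  proof -
    note gv = is_graphD[OF g]
    have inj: "inj_on \<phi> v"
      using bij gv(7)[OF v] by (auto simp: bij_betw_def intro: inj_on_subset)
    have "mset (sorted_list_of_set (\<phi> ` v)) = mset (map \<phi> (sorted_list_of_set v))"
      using inj gv(8)[OF v] by (intro iffD1[OF set_eq_iff_mset_eq_distinct]) (auto simp: distinct_map)
    then have "mset (map (\<lambda>h. e (c' h)) (sorted_list_of_set (\<phi> ` v)))
        = mset (map (\<lambda>h. e (c' h)) (map \<phi> (sorted_list_of_set v)))"
      by (simp only: mset_map)
    also have "map (\<lambda>h. e (c' h)) (map \<phi> (sorted_list_of_set v))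
        = map (\<lambda>h. e ((\<lambda>h\<in>?H. c' (\<phi> h)) h)) (sorted_list_of_set v)"
      using gv(7,8)[OF v] by (auto simp: subset_iff)
    finally have mset_eq: "mset (map (\<lambda>h. e (c' h)) (sorted_list_of_set (\<phi> ` v)))
        = mset (map (\<lambda>h. e ((\<lambda>h\<in>?H. c' (\<phi> h)) h)) (sorted_list_of_set v))" .
    have "card v \<ge> 1"
      using gv(8,9)[OF v] by (simp add: Suc_le_eq card_gt_0_iff)
    from tensor_symmetric_mset[OF sym[OF this] mset_eq] show ?thesis
      using graph_iso_card_vertex[OF g iso v] gv(8)[OF v] by simp
  qed
  have "graph_value d e S \<Gamma>' = (\<Sum>c'\<in>colourings d \<Gamma>'. \<Prod>v\<in>vertices \<Gamma>'. ?t c' v)"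
    by (rule graph_value_eq_sum_colourings[OF g'])
  also have "\<dots> = (\<Sum>c'\<in>colourings d \<Gamma>'. \<Prod>v\<in>vertices \<Gamma>. ?t (\<lambda>h\<in>?H. c' (\<phi> h)) v)"
    unfolding V using vertex by (simp add: prod.reindex[OF graph_iso_inj_vertices[OF g iso]])
  also have "\<dots> = (\<Sum>c\<in>colourings d \<Gamma>. \<Prod>v\<in>vertices \<Gamma>. ?t c v)"
  proof (rule sum.reindex_bij_witness[where i = "\<lambda>c. \<lambda>h\<in>?H'. c (?\<psi> h)" and j = "\<lambda>c'. \<lambda>h\<in>?H. c' (\<phi> h)"])
    fix c' assume c': "c' \<in> colourings d \<Gamma>'"
    show "(\<lambda>h\<in>?H'. (\<lambda>h\<in>?H. c' (\<phi> h)) (?\<psi> h)) = c'"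
      using c' \<psi> by (auto simp: fun_eq_iff colourings_def PiE_iff extensional_def)
    show "(\<lambda>h\<in>?H. c' (\<phi> h)) \<in> colourings d \<Gamma>"
      using c' \<phi> flp is_graphD(3)[OF g] by (auto simp: colourings_def PiE_iff simp flip: flp)
  next
    fix c assume c: "c \<in> colourings d \<Gamma>"
    show "(\<lambda>h\<in>?H. (\<lambda>h\<in>?H'. c (?\<psi> h)) (\<phi> h)) = c"
      using c \<phi> \<psi>\<phi> by (auto simp: fun_eq_iff colourings_def PiE_iff extensional_def)
    have "?\<psi> (flip \<Gamma>' h) = flip \<Gamma> (?\<psi> h)" if "h \<in> ?H'" for h
      using flp[OF \<psi>(1)[OF that]] \<psi>(2)[OF that] \<psi>\<phi>[OF is_graphD(3)[OF g \<psi>(1)[OF that]]] by simp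
    then show "(\<lambda>h\<in>?H'. c (?\<psi> h)) \<in> colourings d \<Gamma>'"
      using c \<psi>(1) is_graphD(3)[OF g'] by (auto simp: colourings_def PiE_iff)
  qed auto
  also have "\<dots> = graph_value d e S \<Gamma>"
    by (rule graph_value_eq_sum_colourings[OF g, symmetric])
  finally show ?thesis .
qed

text \<open>
  Every colouring contributes a multiple of the same monomial, one variable for each vertex.
\<close>

lemma mps_coeff_Z_var:
  assumes "is_graph \<Gamma>"
  shows "mps_coeff (Z_var d e S \<Gamma>) n
    = (if n = block_type (vertices \<Gamma>) then graph_value d (\<lambda>i. of_V (e i)) S \<Gamma> else 0)"
  unfolding Z_var_def graph_value_def mps_coeff_sum mps_var_times_const
    mps_monom_prod[OF is_graphD(6)[OF assms]] block_type_def mps_coeff_monom by simp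

lemma graph_iso_comp:
  assumes "graph_iso \<phi> \<Gamma> \<Gamma>'" "graph_iso \<psi> \<Gamma>' \<Gamma>''"
  shows "graph_iso (\<psi> \<circ> \<phi>) \<Gamma> \<Gamma>''"
proof -
  have "(\<lambda>v. (\<psi> \<circ> \<phi>) ` v) ` vertices \<Gamma> = (\<lambda>v. \<psi> ` v) ` (\<lambda>v. \<phi> ` v) ` vertices \<Gamma>"
    by (simp add: image_image image_comp)
  moreover have "\<phi> h \<in> half_edges \<Gamma>'" if "h \<in> half_edges \<Gamma>" for h
    using assms(1) that by (auto simp: graph_iso_def bij_betw_def)
  ultimately show ?thesis
    using assms by (auto simp: graph_iso_def intro: bij_betw_trans)
qed

lemma graph_iso_cong:
  assumes "graph_iso \<phi> \<Gamma> \<Gamma>'" "is_graph \<Gamma>" "\<And>h. h \<in> half_edges \<Gamma> \<Longrightarrow> \<psi> h = \<phi> h"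
  shows "graph_iso \<psi> \<Gamma> \<Gamma>'"
proof -
  have "\<psi> ` v = \<phi> ` v" if "v \<in> vertices \<Gamma>" for v
    using is_graphD(7)[OF assms(2) that] assms(3) by (intro image_cong refl) auto
  then have "(\<lambda>v. \<psi> ` v) ` vertices \<Gamma> = (\<lambda>v. \<phi> ` v) ` vertices \<Gamma>"
    by (rule image_cong[OF refl])
  moreover have "bij_betw \<psi> (half_edges \<Gamma>) (half_edges \<Gamma>')"
    using assms(1,3) bij_betw_cong[of "half_edges \<Gamma>" \<psi> \<phi>] by (auto simp: graph_iso_def)
  ultimately show ?thesis
    using assms(1,3) is_graphD(3)[OF assms(2)] by (auto simp: graph_iso_def)
qed

text \<open>
  If \<open>\<psi> \<circ> \<alpha>\<close> and \<open>\<psi>\<close> are isomorphisms onto the same graph, then \<open>\<alpha>\<close> is an automorphism. This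
  identifies the fibres of the action on labelled graphs with cosets of \<open>Aut \<Gamma>\<close>.
\<close>

lemma graph_iso_cancel:
  assumes g: "is_graph \<Gamma>" and iso: "graph_iso \<psi> \<Gamma> \<Gamma>'" and comp: "graph_iso (\<psi> \<circ> \<alpha>) \<Gamma> \<Gamma>'"
    and \<alpha>: "bij_betw \<alpha> (half_edges \<Gamma>) (half_edges \<Gamma>)"
  shows "graph_iso \<alpha> \<Gamma> \<Gamma>"
proof -
  let ?H = "half_edges \<Gamma>"
  have inj: "inj_on \<psi> ?H"
    using iso by (auto simp: graph_iso_def bij_betw_def)
  have mem: "\<alpha> h \<in> ?H" if "h \<in> ?H" for h
    using \<alpha> that by (auto simp: bij_betw_def)
  have "(`) \<psi> ` ((`) \<alpha> ` vertices \<Gamma>) = (`) \<psi> ` vertices \<Gamma>"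
    using iso comp by (simp add: graph_iso_def image_comp[symmetric] image_image)
  moreover have "(`) \<alpha> ` vertices \<Gamma> \<subseteq> Pow ?H" "vertices \<Gamma> \<subseteq> Pow ?H"
    using is_graphD(7)[OF g] mem by blast+
  ultimately have "(`) \<alpha> ` vertices \<Gamma> = vertices \<Gamma>"
    by (rule inj_on_image_eq_iff[OF inj_on_image_Pow[OF inj], THEN iffD1, rotated 2])
  moreover have "\<alpha> (flip \<Gamma> h) = flip \<Gamma> (\<alpha> h)" if h: "h \<in> ?H" for h
  proof (rule inj_onD[OF inj])
    show "\<psi> (\<alpha> (flip \<Gamma> h)) = \<psi> (flip \<Gamma> (\<alpha> h))"
      using iso comp h mem[OF h] by (simp add: graph_iso_def)
  qed (use h mem is_graphD(3)[OF g] in auto)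
  ultimately show ?thesis
    using \<alpha> by (simp add: graph_iso_def)
qed

section \<open>Counting labelled graphs in an isomorphism class\<close>

text \<open>
  The involution is fixed to be the identity off the half-edges, so that each graph structure
  on \<open>{..<N}\<close> occurs exactly once.
\<close>

definition labelled_graphs :: "nat \<Rightarrow> nat graph set" where
  "labelled_graphs N = {\<Gamma>. is_graph \<Gamma> \<and> half_edges \<Gamma> = {..<N} \<and> (\<forall>h. h \<notin> {..<N} \<longrightarrow> flip \<Gamma> h = h)}"

lemma labelled_graphs_eq:
  "labelled_graphs N = (\<lambda>(P, \<sigma>). \<lparr>half_edges = {..<N}, vertices = P, flip = \<sigma>\<rparr>) `
    ({P. partition_on {..<N} P} \<times> pairings {..<N})"
proof (intro equalityI subsetI)
  fix \<Gamma> assume \<Gamma>: "\<Gamma> \<in> labelled_graphs N"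
  then have "\<Gamma> = \<lparr>half_edges = {..<N}, vertices = vertices \<Gamma>, flip = flip \<Gamma>\<rparr>"
    by (simp add: labelled_graphs_def)
  moreover have "flip \<Gamma> \<in> pairings {..<N}" "partition_on {..<N} (vertices \<Gamma>)"
    using \<Gamma> by (auto simp: labelled_graphs_def is_graph_def pairings_def)
  ultimately show "\<Gamma> \<in> (\<lambda>(P, \<sigma>). \<lparr>half_edges = {..<N}, vertices = P, flip = \<sigma>\<rparr>) `
      ({P. partition_on {..<N} P} \<times> pairings {..<N})"
    by (force simp: image_iff)
qed (auto simp: labelled_graphs_def is_graph_def pairings_def)

lemma finite_labelled_graphs: "finite (labelled_graphs N)"
  unfolding labelled_graphs_eq
  by (intro finite_imageI finite_cartesian_product finitely_many_partition_on finite_pairings) auto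

lemma labelled_graph_unique:
  assumes "graph_iso \<phi> \<Gamma> \<Gamma>\<^sub>1" "graph_iso \<phi> \<Gamma> \<Gamma>\<^sub>2" "\<Gamma>\<^sub>1 \<in> labelled_graphs N" "\<Gamma>\<^sub>2 \<in> labelled_graphs N"
  shows "\<Gamma>\<^sub>1 = \<Gamma>\<^sub>2"
proof (rule graph.equality)
  show "flip \<Gamma>\<^sub>1 = flip \<Gamma>\<^sub>2"
  proof
    fix x
    show "flip \<Gamma>\<^sub>1 x = flip \<Gamma>\<^sub>2 x"
    proof (cases "x < N")
      case True
      then have "x \<in> \<phi> ` half_edges \<Gamma>"
        using assms(1,3) by (simp add: graph_iso_def bij_betw_def labelled_graphs_def)
      then obtain h where "h \<in> half_edges \<Gamma>" "x = \<phi> h"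
        by auto
      then show ?thesis
        using assms(1,2) unfolding graph_iso_def by metis
    qed (use assms(3,4) in \<open>simp add: labelled_graphs_def\<close>)
  qed
qed (use assms in \<open>simp_all add: labelled_graphs_def graph_iso_def\<close>)

text \<open>
  Transport of structure along a numbering of the half-edges.
\<close>

lemma ex_labelled_graph:
  assumes g: "is_graph \<Gamma>" and \<phi>: "bij_betw \<phi> (half_edges \<Gamma>) {..<N}"
  shows "\<exists>\<Gamma>'\<in>labelled_graphs N. graph_iso \<phi> \<Gamma> \<Gamma>'"
proof -
  let ?H = "half_edges \<Gamma>" and ?\<psi> = "inv_into (half_edges \<Gamma>) \<phi>"
  define \<Gamma>' :: "nat graph" where "\<Gamma>' = \<lparr>half_edges = {..<N}, vertices = (`) \<phi> ` vertices \<Gamma>,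
    flip = (\<lambda>x. if x < N then \<phi> (flip \<Gamma> (?\<psi> x)) else x)\<rparr>"
  have inj: "inj_on \<phi> ?H" and img: "\<phi> ` ?H = {..<N}"
    using \<phi> by (auto simp: bij_betw_def)
  have \<psi>: "?\<psi> x \<in> ?H" "\<phi> (?\<psi> x) = x" if "x < N" for x
    using img that by (auto intro: inv_into_into f_inv_into_f)
  have \<psi>\<phi>: "?\<psi> (\<phi> h) = h" if "h \<in> ?H" for h
    using inj that by simp
  have mem: "\<phi> h < N" if "h \<in> ?H" for h
    using img that by auto
  have "(`) \<phi> ` vertices \<Gamma> - {{}} = (`) \<phi> ` vertices \<Gamma>"
    using is_graphD(9)[OF g] by auto
  then have "partition_on {..<N} (vertices \<Gamma>')"
    using partition_on_inj_image[OF is_graphD(2)[OF g] inj] by (simp add: \<Gamma>'_def img)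
  moreover have "flip \<Gamma>' x \<in> {..<N} \<and> flip \<Gamma>' (flip \<Gamma>' x) = x \<and> flip \<Gamma>' x \<noteq> x" if x: "x < N" for x
  proof -
    let ?h = "flip \<Gamma> (?\<psi> x)"
    have h: "?h \<in> ?H" "flip \<Gamma> ?h = ?\<psi> x" "?h \<noteq> ?\<psi> x"
      using is_graphD(3-5)[OF g \<psi>(1)[OF x]] by auto
    have "\<phi> ?h \<noteq> x"
      using h(1,3) \<psi>\<phi> by metis
    then show ?thesis
      using x mem[OF h(1)] \<psi>\<phi>[OF h(1)] h(2) \<psi>(2)[OF x] by (simp add: \<Gamma>'_def)
  qed
  moreover have he: "half_edges \<Gamma>' = {..<N}" "\<forall>h. h \<notin> {..<N} \<longrightarrow> flip \<Gamma>' h = h"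
    by (auto simp: \<Gamma>'_def)
  ultimately have "\<Gamma>' \<in> labelled_graphs N"
    by (simp add: labelled_graphs_def is_graph_def)
  moreover have "graph_iso \<phi> \<Gamma> \<Gamma>'"
    using \<phi> mem \<psi>\<phi> by (simp add: graph_iso_def \<Gamma>'_def)
  ultimately show ?thesis
    by blast
qed

text \<open>
  The isomorphisms between two isomorphic graphs form a torsor under \<open>Aut \<Gamma>\<close>. They are written
  as \<open>\<beta> \<circ> \<pi>\<close> with a fixed bijection \<open>\<beta>\<close>, so that permutations \<open>\<pi>\<close> are being counted.
\<close>

lemma card_graph_iso_eq_card_Aut:
  assumes g: "is_graph \<Gamma>" and \<psi>: "graph_iso \<psi> \<Gamma> \<Gamma>'"
    and \<beta>: "bij_betw \<beta> (half_edges \<Gamma>) (half_edges \<Gamma>')"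
  shows "card {\<pi>. \<pi> permutes half_edges \<Gamma> \<and> graph_iso (\<beta> \<circ> \<pi>) \<Gamma> \<Gamma>'} = card (Aut \<Gamma>)"
proof -
  let ?H = "half_edges \<Gamma>"
  \<comment> \<open>The permutation with \<open>\<beta> \<circ> \<pi>\<^sub>0 = \<psi>\<close> on the half-edges; it serves as base point of the torsor.\<close>
  define \<pi>\<^sub>0 where "\<pi>\<^sub>0 h = (if h \<in> ?H then inv_into ?H \<beta> (\<psi> h) else h)" for h
  have bij\<psi>: "bij_betw \<psi> ?H (half_edges \<Gamma>')"
    using \<psi> by (simp add: graph_iso_def)
  have "bij_betw (inv_into ?H \<beta> \<circ> \<psi>) ?H ?H"
    by (rule bij_betw_trans[OF bij\<psi> bij_betw_inv_into[OF \<beta>]])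
  then have "bij_betw \<pi>\<^sub>0 ?H ?H"
    by (subst bij_betw_cong[of ?H _ "inv_into ?H \<beta> \<circ> \<psi>"]) (auto simp: \<pi>\<^sub>0_def)
  then have \<pi>\<^sub>0: "\<pi>\<^sub>0 permutes ?H"
    by (intro bij_imp_permutes) (auto simp: \<pi>\<^sub>0_def)
  have "(\<beta> \<circ> \<pi>\<^sub>0) h = \<psi> h" if "h \<in> ?H" for h
    using that bij_betw_inv_into_right[OF \<beta> bij_betwE[OF bij\<psi>, rule_format]] by (simp add: \<pi>\<^sub>0_def)
  then have iso\<^sub>0: "graph_iso (\<beta> \<circ> \<pi>\<^sub>0) \<Gamma> \<Gamma>'"
    by (intro graph_iso_cong[OF \<psi> g])
  have "bij_betw (\<lambda>\<alpha>. \<pi>\<^sub>0 \<circ> \<alpha>) (Aut \<Gamma>) {\<pi>. \<pi> permutes ?H \<and> graph_iso (\<beta> \<circ> \<pi>) \<Gamma> \<Gamma>'}"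
  proof (rule bij_betw_byWitness[where f' = "\<lambda>\<pi>. inv \<pi>\<^sub>0 \<circ> \<pi>"])
    show "(\<lambda>\<alpha>. \<pi>\<^sub>0 \<circ> \<alpha>) ` Aut \<Gamma> \<subseteq> {\<pi>. \<pi> permutes ?H \<and> graph_iso (\<beta> \<circ> \<pi>) \<Gamma> \<Gamma>'}"
      using \<pi>\<^sub>0 graph_iso_comp[OF _ iso\<^sub>0] by (auto simp: Aut_def permutes_compose o_assoc)
    show "(\<lambda>\<pi>. inv \<pi>\<^sub>0 \<circ> \<pi>) ` {\<pi>. \<pi> permutes ?H \<and> graph_iso (\<beta> \<circ> \<pi>) \<Gamma> \<Gamma>'} \<subseteq> Aut \<Gamma>"
    proof (rule image_subsetI, clarify)
      fix \<pi> assume \<pi>: "\<pi> permutes ?H" "graph_iso (\<beta> \<circ> \<pi>) \<Gamma> \<Gamma>'"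
      have perm: "(inv \<pi>\<^sub>0 \<circ> \<pi>) permutes ?H"
        by (intro permutes_compose \<pi>(1) permutes_inv \<pi>\<^sub>0)
      have "\<beta> \<circ> \<pi>\<^sub>0 \<circ> (inv \<pi>\<^sub>0 \<circ> \<pi>) = \<beta> \<circ> \<pi>"
        using permutes_inverses(1)[OF \<pi>\<^sub>0] by (auto simp: fun_eq_iff)
      then have "graph_iso (inv \<pi>\<^sub>0 \<circ> \<pi>) \<Gamma> \<Gamma>"
        using \<pi>(2) by (intro graph_iso_cancel[OF g iso\<^sub>0 _ permutes_imp_bij[OF perm]]) simp
      with perm show "inv \<pi>\<^sub>0 \<circ> \<pi> \<in> Aut \<Gamma>"
        by (simp add: Aut_def)
    qed
  qed (use permutes_inverses[OF \<pi>\<^sub>0] in \<open>auto simp: fun_eq_iff\<close>)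
  then show ?thesis
    by (rule bij_betw_same_card[symmetric])
qed

text \<open>
  Orbit counting: with \<open>\<beta>\<close> a numbering of the half-edges, each permutation \<open>\<pi>\<close> makes \<open>\<beta> \<circ> \<pi>\<close> an
  isomorphism onto exactly one labelled graph, and each labelled graph in the class arises from
  \<open>|Aut \<Gamma>|\<close> permutations.
\<close>

lemma card_labelled_graphs_iso:
  assumes g: "is_graph \<Gamma>" and N: "card (half_edges \<Gamma>) = N"
  shows "card {\<Gamma>' \<in> labelled_graphs N. \<exists>\<phi>. graph_iso \<phi> \<Gamma> \<Gamma>'} * card (Aut \<Gamma>) = fact N"
proof -
  let ?H = "half_edges \<Gamma>"
  let ?X = "{\<Gamma>' \<in> labelled_graphs N. \<exists>\<phi>. graph_iso \<phi> \<Gamma> \<Gamma>'}"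
  have fin: "finite ?H"
    by (rule is_graphD(1)[OF g])
  obtain \<beta> where \<beta>: "bij_betw \<beta> ?H {..<N}"
    using finite_same_card_bij[OF fin, of "{..<N}"] N by auto
  let ?I = "\<lambda>\<Gamma>'. {\<pi>. \<pi> permutes ?H \<and> graph_iso (\<beta> \<circ> \<pi>) \<Gamma> \<Gamma>'}"
  have "{\<pi>. \<pi> permutes ?H} = (\<Union>\<Gamma>'\<in>?X. ?I \<Gamma>')"
  proof (intro equalityI subsetI)
    fix \<pi> assume "\<pi> \<in> {\<pi>. \<pi> permutes ?H}"
    then have \<pi>: "\<pi> permutes ?H"
      by simp
    then have "bij_betw (\<beta> \<circ> \<pi>) ?H {..<N}"
      using bij_betw_trans[OF permutes_imp_bij \<beta>] by blast
    then show "\<pi> \<in> (\<Union>\<Gamma>'\<in>?X. ?I \<Gamma>')"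
      using ex_labelled_graph[OF g] \<pi> by blast
  qed auto
  then have "fact N = card (\<Union>\<Gamma>'\<in>?X. ?I \<Gamma>')"
    using card_permutations[OF N fin] by simp
  also have "\<dots> = (\<Sum>\<Gamma>'\<in>?X. card (?I \<Gamma>'))"
  proof (rule card_UN_disjoint)
    show "\<forall>\<Gamma>'\<in>?X. finite (?I \<Gamma>')"
      using finite_permutations[OF fin] by (auto intro: rev_finite_subset)
    show "\<forall>\<Gamma>\<^sub>1\<in>?X. \<forall>\<Gamma>\<^sub>2\<in>?X. \<Gamma>\<^sub>1 \<noteq> \<Gamma>\<^sub>2 \<longrightarrow> ?I \<Gamma>\<^sub>1 \<inter> ?I \<Gamma>\<^sub>2 = {}"
      using labelled_graph_unique by blast
  qed (simp add: finite_labelled_graphs)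
  also have "\<dots> = (\<Sum>\<Gamma>'\<in>?X. card (Aut \<Gamma>))"
  proof (rule sum.cong[OF refl])
    fix \<Gamma>' assume "\<Gamma>' \<in> ?X"
    then obtain \<phi> where "graph_iso \<phi> \<Gamma> \<Gamma>'" "half_edges \<Gamma>' = {..<N}"
      by (auto simp: labelled_graphs_def)
    then show "card (?I \<Gamma>') = card (Aut \<Gamma>)"
      using \<beta> by (intro card_graph_iso_eq_card_Aut[OF g, of \<phi>]) auto
  qed
  finally show ?thesis
    by simp
qed


section \<open>The two coefficients as sums over labelled graphs\<close>

lemma formal_sum_cong:
  assumes "\<And>i. i \<in> I \<Longrightarrow> f i = g i"
  shows "formal_sum f I = formal_sum g I"
proof -
  have "{i \<in> I. mps_coeff (f i) n \<noteq> 0} = {i \<in> I. mps_coeff (g i) n \<noteq> 0}" for n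
    using assms by auto
  then show ?thesis
    unfolding formal_sum_def using assms by (intro arg_cong[where f = Abs_mps] ext sum.cong) auto
qed

text \<open>
  The value 0 at \<open>k = 0\<close> records that the potential has no term with \<open>x\<^sub>0\<close>.
\<close>

lemma mps_coeff_exp_potential:
  "mps_coeff (exp_potential S v) n
    = exp_coeff (\<lambda>k. if k = 0 then 0 else S k (replicate k (of_V v)) / fact k) n"
proof -
  let ?a = "\<lambda>k. if k = 0 then 0 else S k (replicate k (of_V v)) / fact k"
  have "exp_potential S v = mps_exp (linear_series ?a)"
    unfolding exp_potential_def linear_series_def by (intro arg_cong[where f = mps_exp] formal_sum_cong) auto
  then show ?thesis
    by (simp add: mps_coeff_exp_linear_series)
qed

definition labelled_graphs_of_type :: "(nat \<Rightarrow>\<^sub>0 nat) \<Rightarrow> nat graph set" where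
  "labelled_graphs_of_type n
    = {\<Gamma> \<in> labelled_graphs (weighted_degree id n). block_type (vertices \<Gamma>) = n}"

text \<open>
  The coefficient is a polynomial in \<open>v\<close>, so Wick's formula applies to it term by term. The sums
  over colourings and pairings are then exchanged: for a fixed pairing, the invariant colourings
  add up to the value of a labelled graph.
\<close>

lemma integral_exp_potential_coeff:
  fixes e :: "nat \<Rightarrow> 'a :: real_inner"
  assumes basis: "orthonormal_basis d e" and dv: "translation_invariant_measure dv"
    and lin: "\<And>k. k \<ge> 1 \<Longrightarrow> tensor_linear k (S k)"
  shows "integrable (gaussian dv) (\<lambda>v. mps_coeff (exp_potential S v) n)"
    and "(LINT v|gaussian dv. mps_coeff (exp_potential S v) n)
      = (\<Sum>\<Gamma>\<in>labelled_graphs_of_type n. graph_value d (\<lambda>i. of_V (e i)) S \<Gamma>) / fact (weighted_degree id n)"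
proof -
  define N where "N = weighted_degree id n"
  define \<P> where "\<P> = {P. partition_on {..<N} P \<and> block_type P = n}"
  let ?C = "{..<N} \<rightarrow>\<^sub>E {..<d}"
  let ?T = "\<lambda>P c. \<Prod>B\<in>P. S (card B) (map (\<lambda>h. of_V (e (c h))) (sorted_list_of_set B))"
  let ?L = "\<lambda>c v. complex_of_real (linear_product (e \<circ> c) {..<N} v)"
  let ?count = "\<lambda>c. \<Sum>\<sigma>\<in>pairings {..<N}. if \<forall>h\<in>{..<N}. c (\<sigma> h) = c h then 1 else 0"
  have fin: "finite \<P>" "finite ?C" "finite (pairings {..<N})"
    using finitely_many_partition_on[of "{..<N}"]
    by (auto simp: \<P>_def finite_pairings intro: finite_PiE rev_finite_subset)
  have coeff: "mps_coeff (exp_potential S v) n = (\<Sum>P\<in>\<P>. \<Sum>c\<in>?C. ?L c v * ?T P c) / fact N" for v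
  proof -
    let ?a = "\<lambda>k. if k = 0 then 0 else S k (replicate k (of_V v)) / fact k"
    have "(\<Sum>P | partition_on {..<N} P \<and> block_type P = n. \<Prod>B\<in>P. S (card B) (replicate (card B) (of_V v)))
        = fact (card {..<N}) * exp_coeff ?a n"
      by (rule sum_partitions_prod_card) (auto simp: N_def)
    then have "fact N * exp_coeff ?a n = (\<Sum>P\<in>\<P>. \<Prod>B\<in>P. S (card B) (replicate (card B) (of_V v)))"
      unfolding \<P>_def card_lessThan by (rule sym)
    also have "\<dots> = (\<Sum>P\<in>\<P>. \<Sum>c\<in>?C. ?L c v * ?T P c)"
      unfolding linear_product_def comp_def
      by (intro sum.cong refl prod_tensor_expansion[OF basis lin]) (auto simp: \<P>_def)
    finally show ?thesis
      by (simp add: mps_coeff_exp_potential field_simps)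
  qed
  have int: "integrable (gaussian dv) (?L c)" if "c \<in> ?C" for c
    using that norm_basis[OF basis]
    by (intro integrable_of_real integrable_linear_product[OF basis dv]) (auto simp: PiE_iff)
  then show "integrable (gaussian dv) (\<lambda>v. mps_coeff (exp_potential S v) n)"
    unfolding coeff by (intro integrable_divide_zero Bochner_Integration.integrable_sum integrable_mult_left) auto
  have wick: "(LINT v|gaussian dv. ?L c v) = ?count c" if "c \<in> ?C" for c
  proof -
    have "(LINT v|gaussian dv. linear_product (e \<circ> c) {..<N} v) = ?count c"
      using that by (intro wick_formula[OF basis dv]) auto
    then show ?thesis
      by (simp add: if_distrib cong: if_cong)
  qed
  have "(LINT v|gaussian dv. mps_coeff (exp_potential S v) n)
      = (\<Sum>P\<in>\<P>. \<Sum>c\<in>?C. (LINT v|gaussian dv. ?L c v) * ?T P c) / fact N"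
    unfolding coeff using int
    by (simp add: Bochner_Integration.integral_sum Bochner_Integration.integrable_sum)
  also have "\<dots> = (\<Sum>P\<in>\<P>. \<Sum>c\<in>?C. ?count c * ?T P c) / fact N"
    using wick by simp
  also have "(\<Sum>P\<in>\<P>. \<Sum>c\<in>?C. ?count c * ?T P c)
      = (\<Sum>P\<in>\<P>. \<Sum>\<sigma>\<in>pairings {..<N}. graph_value d (\<lambda>i. of_V (e i)) S
          \<lparr>half_edges = {..<N}, vertices = P, flip = \<sigma>\<rparr>)"
  proof (rule sum.cong[OF refl])
    fix P assume P: "P \<in> \<P>"
    have "(\<Sum>c\<in>?C. ?count c * ?T P c)
        = (\<Sum>c\<in>?C. \<Sum>\<sigma>\<in>pairings {..<N}. if \<forall>h\<in>{..<N}. c (\<sigma> h) = c h then ?T P c else 0)"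
      by (simp add: sum_distrib_right if_distrib[of "\<lambda>x. x * _"] cong: if_cong)
    also have "\<dots> = (\<Sum>\<sigma>\<in>pairings {..<N}. \<Sum>c\<in>?C. if \<forall>h\<in>{..<N}. c (\<sigma> h) = c h then ?T P c else 0)"
      by (rule sum.swap)
    also have "\<dots> = (\<Sum>\<sigma>\<in>pairings {..<N}. graph_value d (\<lambda>i. of_V (e i)) S
          \<lparr>half_edges = {..<N}, vertices = P, flip = \<sigma>\<rparr>)"
    proof (rule sum.cong[OF refl])
      fix \<sigma> assume \<sigma>: "\<sigma> \<in> pairings {..<N}"
      let ?\<Gamma> = "\<lparr>half_edges = {..<N}, vertices = P, flip = \<sigma>\<rparr>"
      have "is_graph ?\<Gamma>"
        using P \<sigma> by (simp add: is_graph_def \<P>_def pairings_def)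
      then have "graph_value d (\<lambda>i. of_V (e i)) S ?\<Gamma> = (\<Sum>c\<in>colourings d ?\<Gamma>. ?T P c)"
        by (simp add: graph_value_eq_sum_colourings)
      also have "\<dots> = (\<Sum>c\<in>?C. if \<forall>h\<in>{..<N}. c (\<sigma> h) = c h then ?T P c else 0)"
        unfolding colourings_def by (subst sum.inter_filter[OF fin(2), symmetric]) simp
      finally show "(\<Sum>c\<in>?C. if \<forall>h\<in>{..<N}. c (\<sigma> h) = c h then ?T P c else 0)
          = graph_value d (\<lambda>i. of_V (e i)) S ?\<Gamma>" ..
    qed
    finally show "(\<Sum>c\<in>?C. ?count c * ?T P c)
      = (\<Sum>\<sigma>\<in>pairings {..<N}. graph_value d (\<lambda>i. of_V (e i)) S
          \<lparr>half_edges = {..<N}, vertices = P, flip = \<sigma>\<rparr>)" .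
  qed
  also have "\<dots> = (\<Sum>\<Gamma>\<in>labelled_graphs_of_type n. graph_value d (\<lambda>i. of_V (e i)) S \<Gamma>)"
  proof -
    let ?g = "\<lambda>(P, \<sigma>). \<lparr>half_edges = {..<N}, vertices = P, flip = \<sigma>\<rparr> :: nat graph"
    have "labelled_graphs_of_type n = ?g ` (\<P> \<times> pairings {..<N})"
    proof (intro equalityI subsetI)
      fix \<Gamma> assume "\<Gamma> \<in> labelled_graphs_of_type n"
      then obtain P \<sigma> where \<Gamma>: "\<Gamma> = ?g (P, \<sigma>)" "partition_on {..<N} P" "\<sigma> \<in> pairings {..<N}" "block_type (vertices \<Gamma>) = n"
        unfolding labelled_graphs_of_type_def labelled_graphs_eq N_def[symmetric] by auto
      then have "(P, \<sigma>) \<in> \<P> \<times> pairings {..<N}"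
        by (simp add: \<P>_def)
      then show "\<Gamma> \<in> ?g ` (\<P> \<times> pairings {..<N})"
        unfolding \<Gamma>(1) by (rule imageI)
    qed (auto simp: labelled_graphs_of_type_def labelled_graphs_eq \<P>_def N_def)
    moreover have "inj_on ?g (\<P> \<times> pairings {..<N})"
      by (auto simp: inj_on_def)
    ultimately show ?thesis
      by (simp add: sum.cartesian_product sum.reindex case_prod_unfold)
  qed
  finally show "(LINT v|gaussian dv. mps_coeff (exp_potential S v) n)
      = (\<Sum>\<Gamma>\<in>labelled_graphs_of_type n. graph_value d (\<lambda>i. of_V (e i)) S \<Gamma>) / fact (weighted_degree id n)"
    by (simp add: N_def)
qed

lemma some_in_G00:
  assumes "C \<in> G00"
  shows "(SOME \<Gamma>. \<Gamma> \<in> C) \<in> C" "is_graph (SOME \<Gamma>. \<Gamma> \<in> C)" "C = graph_isomorphic `` {SOME \<Gamma>. \<Gamma> \<in> C}"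
proof -
  show in_C: "(SOME \<Gamma>. \<Gamma> \<in> C) \<in> C"
    using in_quotient_imp_non_empty[OF equiv_graph_isomorphic, of C] assms
    by (auto simp: G00_def some_in_eq)
  then show "is_graph (SOME \<Gamma>. \<Gamma> \<in> C)"
    using in_quotient_imp_subset[OF equiv_graph_isomorphic, of C] assms by (auto simp: G00_def)
  show "C = graph_isomorphic `` {SOME \<Gamma>. \<Gamma> \<in> C}"
    using assms in_C unfolding G00_def
    by (metis Image_singleton_iff equiv_class_eq equiv_graph_isomorphic quotientE)
qed

text \<open>
  All labelled graphs in the class have the value of the chosen representative \<open>\<Gamma>\<close>, and there are
  \<open>N! / |Aut \<Gamma>|\<close> of them.
\<close>

lemma mps_coeff_class_term:
  fixes S :: "nat \<Rightarrow> 'a :: real_vector complexification list \<Rightarrow> complex"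
  assumes sym: "\<And>k. k \<ge> 1 \<Longrightarrow> tensor_symmetric k (S k)" and C: "C \<in> G00"
  shows "mps_coeff (class_term d e S C) n
    = (\<Sum>\<Gamma> | \<Gamma> \<in> labelled_graphs_of_type n \<and> graph_isomorphic `` {\<Gamma>} = C.
        graph_value d (\<lambda>i. of_V (e i)) S \<Gamma>) / fact (weighted_degree id n)"
proof -
  define \<Gamma> where "\<Gamma> = (SOME \<Gamma>. \<Gamma> \<in> C)"
  have g: "is_graph \<Gamma>" and C_eq: "C = graph_isomorphic `` {\<Gamma>}"
    using some_in_G00[OF C] by (simp_all add: \<Gamma>_def)
  let ?Z = "graph_value d (\<lambda>i. of_V (e i)) S"
  have coeff: "mps_coeff (class_term d e S C) n
      = (if n = block_type (vertices \<Gamma>) then ?Z \<Gamma> / of_nat (card (Aut \<Gamma>)) else 0)"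
    using g by (simp add: class_term_def \<Gamma>_def[symmetric] mps_coeff_const_mult mps_coeff_Z_var)
  have class_iff: "graph_isomorphic `` {\<Gamma>'} = C \<longleftrightarrow> (\<exists>\<phi>. graph_iso \<phi> \<Gamma> \<Gamma>')" if "is_graph \<Gamma>'" for \<Gamma>'
  proof -
    have "graph_isomorphic `` {\<Gamma>'} = C \<longleftrightarrow> (\<Gamma>, \<Gamma>') \<in> graph_isomorphic"
      using eq_equiv_class_iff[OF equiv_graph_isomorphic, of \<Gamma> \<Gamma>'] g that by (auto simp: C_eq)
    then show ?thesis
      using g that by (simp add: graph_isomorphic_def)
  qed
  show ?thesis
  proof (cases "n = block_type (vertices \<Gamma>)")
    case True
    have N: "card (half_edges \<Gamma>) = weighted_degree id n"
      using weighted_degree_block_type[OF is_graphD(2,1)[OF g]] by (simp add: True)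
    have set_eq: "{\<Gamma>' \<in> labelled_graphs_of_type n. graph_isomorphic `` {\<Gamma>'} = C}
        = {\<Gamma>' \<in> labelled_graphs (weighted_degree id n). \<exists>\<phi>. graph_iso \<phi> \<Gamma> \<Gamma>'}" (is "?X = ?Y")
      using class_iff block_type_iso[OF g]
      by (auto simp: labelled_graphs_of_type_def labelled_graphs_def True)
    have "(\<Sum>\<Gamma>'\<in>?Y. ?Z \<Gamma>') = (\<Sum>\<Gamma>'\<in>?Y. ?Z \<Gamma>)"
      using graph_value_iso[OF g _ _ sym] by (intro sum.cong refl) (auto simp: labelled_graphs_def)
    then have sum: "(\<Sum>\<Gamma>'\<in>?Y. ?Z \<Gamma>') = of_nat (card ?Y) * ?Z \<Gamma>"
      by simp
    have card: "card ?Y * card (Aut \<Gamma>) = fact (weighted_degree id n)"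
      by (rule card_labelled_graphs_iso[OF g N])
    then have "card (Aut \<Gamma>) \<noteq> 0"
      by (metis fact_nonzero mult_0_right)
    moreover have "(of_nat (card ?Y) * of_nat (card (Aut \<Gamma>)) :: complex) = fact (weighted_degree id n)"
      using card by (metis of_nat_fact of_nat_mult)
    ultimately have "?Z \<Gamma> / of_nat (card (Aut \<Gamma>)) = of_nat (card ?Y) * ?Z \<Gamma> / fact (weighted_degree id n)"
      by (simp add: field_simps)
    then show ?thesis
      unfolding set_eq sum coeff using True by simp
  next
    case False
    have "{\<Gamma>' \<in> labelled_graphs_of_type n. graph_isomorphic `` {\<Gamma>'} = C} = {}"
      using class_iff block_type_iso[OF g] False
      by (auto simp: labelled_graphs_of_type_def labelled_graphs_def)
    then show ?thesis
      unfolding coeff using False by (simp only: sum.empty if_False div_0)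
  qed
qed

theorem theorem3p2:
  fixes d :: nat
    and e :: "nat \<Rightarrow> 'a :: real_inner"
    and dv :: "'a measure"
    and S :: "nat \<Rightarrow> 'a complexification list \<Rightarrow> complex"
  assumes "orthonormal_basis d e"
    and "translation_invariant_measure dv"
    and "\<And>k. k \<ge> 1 \<Longrightarrow> tensor_linear k (S k)"
    and "\<And>k. k \<ge> 1 \<Longrightarrow> tensor_symmetric k (S k)"
  shows "mps_integrable (gaussian dv) (exp_potential S)
       \<and> formally_summable (class_term d e S) G00
       \<and> mps_integral (gaussian dv) (exp_potential S) = formal_sum (class_term d e S) G00"
proof (intro conjI)
  let ?Z = "graph_value d (\<lambda>i. of_V (e i)) S"
  let ?X = "labelled_graphs_of_type"
  let ?cls = "\<lambda>\<Gamma>. graph_isomorphic `` {\<Gamma>}"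
  let ?c = "\<lambda>n C. mps_coeff (class_term d e S C) n"
  note integral = integral_exp_potential_coeff[of d e dv S, OF assms(1-3)]
  show "mps_integrable (gaussian dv) (exp_potential S)"
    using integral(1) by (simp add: mps_integrable_def)
  have finX: "finite (?X n)" for n
    by (simp add: labelled_graphs_of_type_def finite_labelled_graphs)
  have classes: "?cls ` ?X n \<subseteq> G00" for n
    by (auto simp: G00_def labelled_graphs_of_type_def labelled_graphs_def intro: quotientI)
  have nonzero: "{C \<in> G00. ?c n C \<noteq> 0} \<subseteq> ?cls ` ?X n" for n
  proof
    fix C assume "C \<in> {C \<in> G00. ?c n C \<noteq> 0}"
    then have "(\<Sum>\<Gamma> | \<Gamma> \<in> ?X n \<and> ?cls \<Gamma> = C. ?Z \<Gamma>) \<noteq> 0"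
      using mps_coeff_class_term[of S C d e n, OF assms(4)] by auto
    then have "{\<Gamma>. \<Gamma> \<in> ?X n \<and> ?cls \<Gamma> = C} \<noteq> {}"
      by (metis (no_types, lifting) sum.empty)
    then show "C \<in> ?cls ` ?X n"
      by blast
  qed
  show "formally_summable (class_term d e S) G00"
    unfolding formally_summable_def
    using finite_subset[OF nonzero finite_imageI[OF finX]] by blast
  show "mps_integral (gaussian dv) (exp_potential S) = formal_sum (class_term d e S) G00"
  proof (rule mps_eqI)
    fix n
    have "mps_coeff (formal_sum (class_term d e S) G00) n = (\<Sum>C | C \<in> G00 \<and> ?c n C \<noteq> 0. ?c n C)"
      by (simp add: formal_sum_def)
    also have "\<dots> = (\<Sum>C\<in>?cls ` ?X n. ?c n C)"
      using finX[of n] nonzero[of n] classes[of n] by (intro sum.mono_neutral_left) auto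
    also have "\<dots> = (\<Sum>C\<in>?cls ` ?X n. (\<Sum>\<Gamma> | \<Gamma> \<in> ?X n \<and> ?cls \<Gamma> = C. ?Z \<Gamma>) / fact (weighted_degree id n))"
      using classes[of n] by (intro sum.cong refl mps_coeff_class_term[OF assms(4)]) auto
    also have "\<dots> = (\<Sum>\<Gamma>\<in>?X n. ?Z \<Gamma>) / fact (weighted_degree id n)"
      unfolding sum_divide_distrib[symmetric] sum.image_gen[OF finX, symmetric] ..
    also have "\<dots> = mps_coeff (mps_integral (gaussian dv) (exp_potential S)) n"
      by (simp add: mps_integral_def integral(2))
    finally show "mps_coeff (mps_integral (gaussian dv) (exp_potential S)) n
        = mps_coeff (formal_sum (class_term d e S) G00) n" ..
  qed
qed

end
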